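(* Let $A=\mathbb C\langle v_1,\ldots,v_n\rangle/(e_1,\ldots,e_p)$, where each generator $v_k$ is assigned a positive integer degree $m_k$. Suppose that the defining relations $e_1,\ldots,e_p$ of $A$ are monomial (i.e. each is given by a single word) and pairwise non-overlapping. Then $A$ is an asymptotic RCI.
   Context: Two (possibly equal) nonempty words $e,f$ in the alphabet $v_1,\dots,v_n$ are non-overlapping if neither is a proper subword of the other and neither begins the way the other one ends; equivalently, any word $w$ that contains both $e$ and $f$ (in different ways if $e=f$) is of the form $w_1ew_2fw_3$ or $w_1fw_2ew_3$. (For $e=f$ the second condition means that no nonempty proper prefix of $e$ is a suffix of $e$.) "Pairwise non-overlapping" includes that each $e_i$ is non-overlapping with itself; the words $e_1,\dots,e_p$ are distinct. Asymptotic RCI (for ground ring $\mathbb C$): let $V$ be the graded vector space with basis $v_1,\dots,v_n$, $TV=\mathbb C\langle v_1,\dots,v_n\rangle$, and $L\subset TV$ the graded span of $e_1,\dots,e_p$. Put $L^\circ=L\cap[TV,TV]$, where $[TV,TV]$ is the linear span of commutators. For an integer $d\ge1$ let $\mathbf E_d=\mathrm{End}(\mathbb C^d)$, $\mathbb V_d=\mathrm{Hom}_{\mathbb C}(V,\mathbf E_d)$, $\mathbb L_d=\mathrm{Hom}_{\mathbb C}(L,\mathbf E_d)$. Each $\rho\in\mathbb V_d$ extends to an algebra map $TV\to\mathbf E_d$; restricting it to $L$ gives a morphism $\mathbb V_d\to\mathbb L_d$ whose image lies in $\mathbb L^\sharp_d:=\{\varphi\in\mathbb L_d:\mathrm{Tr}\,\varphi(\ell)=0\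 \forall \ell\in L^\circ\}$; let $p_d:\mathbb V_d\to\mathbb L^\sharp_d$ be the resulting morphism, whose scheme-theoretic zero fiber is the representation scheme $\mathrm{Rep}_dA$. The Koszul complex $\mathbf K_\bullet(\mathrm{Rep}_dA)=\mathbb C[\mathbb V_d]\otimes\Lambda^\bullet(\mathbb L^\sharp_d)^*$ has the $\mathbb C[\mathbb V_d]$-linear derivation $d_K$ of degree $-1$ with $d_K(f)=f\circ p_d$ for $f\in(\mathbb L_d^\sharp)^*$, and a weight grading preserved by $d_K$ in which linear functions on $\mathbb V_d$, resp. $\mathbb L_d$, coming from degree $r$ elements of $V$, resp. $L$, have weight $r$; $[s]$ is the weight $s$ part. $A$ is an asymptotic RCI if for any positive integers $r,N$ there is $d>N$ with $H_p\big(\bigoplus_{s\le r}\mathbf K_\bullet(\mathrm{Rep}_dA)[s],d_K\big)=0$ for all $p>0$. *)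

theory Defs
  imports "HOL-Library.Poly_Mapping" "HOL-Library.Sublist" "HOL-Library.Nat_Bijection"
    "Jordan_Normal_Form.Matrix"
begin

section \<open>Non-overlapping words\<close>

text \<open>The last two conditions also cover \<^term>\<open>e = f\<close>: then only the whole word may be a common
  prefix and suffix.\<close>

definition nonoverlapping :: "'v list \<Rightarrow> 'v list \<Rightarrow> bool" where
  "nonoverlapping e f \<longleftrightarrow> e \<noteq> [] \<and> f \<noteq> [] \<and>
     \<not> strict_sublist e f \<and> \<not> strict_sublist f e \<and>
     (\<forall>u. u \<noteq> [] \<and> prefix u e \<and> suffix u f \<longrightarrow> e = f \<and> u = e) \<and>
     (\<forall>u. u \<noteq> [] \<and> prefix u f \<and> suffix u e \<longrightarrow> e = f \<and> u = e)"

section \<open>The free algebra\<close>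

datatype 'v word = Word (letters: "'v list")

instantiation word :: (type) monoid_add
begin
definition "0 = Word []"
definition "w + w' = Word (letters w @ letters w')"
instance by standard (simp_all add: zero_word_def plus_word_def)
end

text \<open>The monoid algebra of the free monoid on \<open>'v\<close>. For a finite type \<open>'v\<close> this is \<open>TV\<close>, where
  \<open>V\<close> has basis \<open>'v\<close> and \<open>n = CARD('v)\<close>.\<close>

type_synonym 'v ncpoly = "'v word \<Rightarrow>\<^sub>0 complex"

definition nc_scale :: "complex \<Rightarrow> 'v ncpoly \<Rightarrow> 'v ncpoly" where
  "nc_scale c f = Poly_Mapping.single 0 c * f"

global_interpretation nc: vector_space nc_scale
  by standard
    (simp_all add: nc_scale_def algebra_simps single_add mult_single flip: mult.assoc)

definition nc_monomial :: "'v list \<Rightarrow> 'v ncpoly" where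
  "nc_monomial w = Poly_Mapping.single (Word w) 1"

definition commutator_space :: "'v ncpoly set" where
  "commutator_space = nc.span {f * g - g * f | f g. True}"

definition word_weight :: "('v \<Rightarrow> nat) \<Rightarrow> 'v word \<Rightarrow> nat" where
  "word_weight m w = (\<Sum>k\<leftarrow>letters w. m k)"

definition nc_homogeneous :: "('v \<Rightarrow> nat) \<Rightarrow> nat \<Rightarrow> 'v ncpoly \<Rightarrow> bool" where
  "nc_homogeneous m r f \<longleftrightarrow> (\<forall>w \<in> Poly_Mapping.keys f. word_weight m w = r)"

text \<open>The degree of a homogeneous element (unique if the element is nonzero).\<close>

definition nc_degree :: "('v \<Rightarrow> nat) \<Rightarrow> 'v ncpoly \<Rightarrow> nat" where
  "nc_degree m f = (SOME r. nc_homogeneous m r f)"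

text \<open>The list \<open>es\<close> is a homogeneous basis of the graded space \<open>L\<close> of relations.\<close>

definition homogeneous_basis :: "('v \<Rightarrow> nat) \<Rightarrow> 'v ncpoly list \<Rightarrow> bool" where
  "homogeneous_basis m es \<longleftrightarrow>
     distinct es \<and> \<not> nc.dependent (set es) \<and> (\<forall>e \<in> set es. \<exists>r. nc_homogeneous m r e)"

section \<open>Coordinate ring of the space of tuples of matrices\<close>

text \<open>Polynomials in variables \<open>(k, i, j)\<close>; this variable is the linear function
  \<open>\<rho> \<mapsto> \<rho>(v\<^sub>k)\<^sub>i\<^sub>j\<close>. The ring \<open>\<complex>[\<bbbV>\<^sub>d]\<close> is \<open>coord_ring d\<close>.\<close>

type_synonym 'v cpoly = "(('v \<times> nat \<times> nat) \<Rightarrow>\<^sub>0 nat) \<Rightarrow>\<^sub>0 complex"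

definition coord_ring :: "nat \<Rightarrow> 'v cpoly set" where
  "coord_ring d = {f. \<forall>\<alpha> \<in> Poly_Mapping.keys f. Poly_Mapping.keys \<alpha> \<subseteq> UNIV \<times> {..<d} \<times> {..<d}}"

definition cconst :: "complex \<Rightarrow> 'v cpoly" where
  "cconst c = Poly_Mapping.single 0 c"

definition cvar :: "'v \<times> nat \<times> nat \<Rightarrow> 'v cpoly" where
  "cvar x = Poly_Mapping.single (Poly_Mapping.single x 1) 1"

definition generic_mat :: "nat \<Rightarrow> 'v \<Rightarrow> 'v cpoly mat" where
  "generic_mat d k = mat d d (\<lambda>(i, j). cvar (k, i, j))"

definition word_mat :: "nat \<Rightarrow> 'v word \<Rightarrow> 'v cpoly mat" where
  "word_mat d w = foldr (\<lambda>k M. generic_mat d k * M) (letters w) (1\<^sub>m d)"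

text \<open>The polynomial function \<open>\<rho> \<mapsto> \<rho>(f)\<^sub>i\<^sub>j\<close>, where \<open>\<rho>\<close> is extended to an algebra map on \<open>TV\<close>.\<close>

definition nc_eval_entry :: "nat \<Rightarrow> 'v ncpoly \<Rightarrow> nat \<Rightarrow> nat \<Rightarrow> 'v cpoly" where
  "nc_eval_entry d f i j =
     (\<Sum>w \<in> Poly_Mapping.keys f. cconst (Poly_Mapping.lookup f w) * (word_mat d w $$ (i, j)))"

definition monom_weight :: "('v \<Rightarrow> nat) \<Rightarrow> (('v \<times> nat \<times> nat) \<Rightarrow>\<^sub>0 nat) \<Rightarrow> nat" where
  "monom_weight m \<alpha> = (\<Sum>x \<in> Poly_Mapping.keys \<alpha>. Poly_Mapping.lookup \<alpha> x * m (fst x))"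

section \<open>The Koszul complex\<close>

text \<open>The triple \<open>(a, i, j)\<close> names the linear function \<open>y\<^sub>a\<^sub>i\<^sub>j : \<phi> \<mapsto> \<phi>(e\<^sub>a)\<^sub>i\<^sub>j\<close> on \<open>\<bbbL>\<^sub>d\<close>.
  The exterior algebra \<open>\<complex>[\<bbbV>\<^sub>d] \<otimes> \<Lambda>(\<bbbL>\<^sub>d)\<^sup>*\<close> is the free module on the monomials
  \<open>y\<^sub>S = y\<^bsub>s\<^sub>1\<^esub> \<and> \<dots> \<and> y\<^bsub>s\<^sub>q\<^esub>\<close> for finite sets \<open>S\<close> of triples with \<open>s\<^sub>1 < \<dots> < s\<^sub>q\<close>. The choice
  of total order on triples is immaterial; we compare their codes.\<close>

type_synonym ridx = "nat \<times> nat \<times> nat"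

type_synonym 'v ext = "ridx set \<Rightarrow>\<^sub>0 'v cpoly"

definition ridx_code :: "ridx \<Rightarrow> nat" where
  "ridx_code = (\<lambda>(a, i, j). prod_encode (a, prod_encode (i, j)))"

text \<open>For disjoint \<open>S\<close> and \<open>T\<close>, the sign in \<open>y\<^sub>S \<and> y\<^sub>T = \<plusminus> y\<^bsub>S \<union> T\<^esub>\<close>.\<close>

definition ext_sign :: "ridx set \<Rightarrow> ridx set \<Rightarrow> 'a::comm_ring_1" where
  "ext_sign S T = (-1) ^ card {(s, t). s \<in> S \<and> t \<in> T \<and> ridx_code t < ridx_code s}"

definition wedge_basis :: "ridx set \<Rightarrow> ridx set \<Rightarrow> 'v cpoly \<Rightarrow> 'v ext" where
  "wedge_basis S T c =
     (if S \<inter> T = {} then Poly_Mapping.single (S \<union> T) (ext_sign S T * c) else 0)"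

definition wedge :: "'v ext \<Rightarrow> 'v ext \<Rightarrow> 'v ext" where
  "wedge \<xi> \<eta> = (\<Sum>S \<in> Poly_Mapping.keys \<xi>. \<Sum>T \<in> Poly_Mapping.keys \<eta>.
     wedge_basis S T (Poly_Mapping.lookup \<xi> S * Poly_Mapping.lookup \<eta> T))"

definition ext_scale :: "'v cpoly \<Rightarrow> 'v ext \<Rightarrow> 'v ext" where
  "ext_scale c \<xi> = Poly_Mapping.map ((*) c) \<xi>"

definition ext_alg :: "'v ncpoly list \<Rightarrow> nat \<Rightarrow> 'v ext set" where
  "ext_alg es d = {\<xi>. \<forall>S \<in> Poly_Mapping.keys \<xi>.
     S \<subseteq> {..<length es} \<times> {..<d} \<times> {..<d} \<and> Poly_Mapping.lookup \<xi> S \<in> coord_ring d}"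

definition ext_deg :: "nat \<Rightarrow> 'v ext set" where
  "ext_deg q = {\<xi>. \<forall>S \<in> Poly_Mapping.keys \<xi>. finite S \<and> card S = q}"

text \<open>The direct sum of the weight components of weight at most \<open>r\<close>.\<close>

definition ext_weight_le ::
    "('v \<Rightarrow> nat) \<Rightarrow> 'v ncpoly list \<Rightarrow> nat \<Rightarrow> 'v ext set" where
  "ext_weight_le m es r = {\<xi>. \<forall>S \<in> Poly_Mapping.keys \<xi>.
     \<forall>\<alpha> \<in> Poly_Mapping.keys (Poly_Mapping.lookup \<xi> S).
       monom_weight m \<alpha> + (\<Sum>(a, i, j) \<in> S. nc_degree m (es ! a)) \<le> r}"

text \<open>The pullback \<open>y\<^sub>a\<^sub>i\<^sub>j \<circ> p\<^sub>d\<close> and the derivation it determines; see \<open>koszul_d_generator\<close>,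
  \<open>koszul_d_coeff\<close>, \<open>koszul_d_scale\<close> and \<open>koszul_d_wedge\<close> below.\<close>

definition pullback :: "'v ncpoly list \<Rightarrow> nat \<Rightarrow> ridx \<Rightarrow> 'v cpoly" where
  "pullback es d = (\<lambda>(a, i, j). nc_eval_entry d (es ! a) i j)"

definition koszul_d_basis :: "'v ncpoly list \<Rightarrow> nat \<Rightarrow> ridx set \<Rightarrow> 'v cpoly \<Rightarrow> 'v ext" where
  "koszul_d_basis es d S c =
     (\<Sum>s \<in> S. Poly_Mapping.single (S - {s}) (ext_sign {s} (S - {s}) * pullback es d s * c))"

definition koszul_d :: "'v ncpoly list \<Rightarrow> nat \<Rightarrow> 'v ext \<Rightarrow> 'v ext" where
  "koszul_d es d \<xi> =
     (\<Sum>S \<in> Poly_Mapping.keys \<xi>. koszul_d_basis es d S (Poly_Mapping.lookup \<xi> S))"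

text \<open>The subspace \<open>\<bbbL>\<^sup>\<sharp>\<^sub>d\<close> is cut out in \<open>\<bbbL>\<^sub>d\<close> by the linear functions
  \<open>\<phi> \<mapsto> Tr \<phi>(\<ell>)\<close> with \<open>\<ell> = \<Sum> c\<^sub>a e\<^sub>a \<in> L \<inter> [TV, TV]\<close>. Hence its dual is the quotient of
  \<open>(\<bbbL>\<^sub>d)\<^sup>*\<close> by \<open>trace_forms\<close>, and \<open>\<complex>[\<bbbV>\<^sub>d] \<otimes> \<Lambda>(\<bbbL>\<^sup>\<sharp>\<^sub>d)\<^sup>*\<close> is the quotient of
  \<open>ext_alg\<close> by the ideal they generate. (As these generators are odd elements of a
  graded-commutative algebra, the left ideal is two-sided.)\<close>

definition trace_form :: "'v ncpoly list \<Rightarrow> nat \<Rightarrow> (nat \<Rightarrow> complex) \<Rightarrow> 'v ext" where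
  "trace_form es d c =
     (\<Sum>a < length es. \<Sum>i < d. Poly_Mapping.single {(a, i, i)} (cconst (c a)))"

definition trace_forms :: "'v ncpoly list \<Rightarrow> nat \<Rightarrow> 'v ext set" where
  "trace_forms es d =
     {trace_form es d c | c. (\<Sum>a < length es. nc_scale (c a) (es ! a)) \<in> commutator_space}"

inductive_set trace_ideal :: "'v ncpoly list \<Rightarrow> nat \<Rightarrow> 'v ext set"
  for es :: "'v ncpoly list" and d :: nat where
  zero: "0 \<in> trace_ideal es d"
| add: "\<lbrakk>\<xi> \<in> trace_ideal es d; \<tau> \<in> trace_forms es d; \<eta> \<in> ext_alg es d\<rbrakk>
        \<Longrightarrow> \<xi> + wedge \<eta> \<tau> \<in> trace_ideal es d"

text \<open>Vanishing in homological degree \<open>q\<close> of the homology of the part of weight at most \<open>r\<close> of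
  the quotient complex, in terms of representatives modulo \<open>trace_ideal\<close>. This ideal is
  homogeneous for both gradings, so homogeneous classes have homogeneous representatives.\<close>

definition koszul_homology_vanishes ::
    "('v \<Rightarrow> nat) \<Rightarrow> 'v ncpoly list \<Rightarrow> nat \<Rightarrow> nat \<Rightarrow> nat \<Rightarrow> bool" where
  "koszul_homology_vanishes m es d r q \<longleftrightarrow>
     (\<forall>\<xi> \<in> ext_alg es d \<inter> ext_deg q \<inter> ext_weight_le m es r.
        koszul_d es d \<xi> \<in> trace_ideal es d \<longrightarrow>
        (\<exists>\<eta> \<in> ext_alg es d \<inter> ext_deg (Suc q) \<inter> ext_weight_le m es r.
           \<xi> - koszul_d es d \<eta> \<in> trace_ideal es d))"

text \<open>\<open>TV/(es)\<close> is an asymptotic RCI, where \<open>v\<^sub>k\<close> has degree \<open>m k\<close> and \<open>L\<close> has basis \<open>es\<close>.\<close>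

definition asymptotic_RCI :: "('v::finite \<Rightarrow> nat) \<Rightarrow> 'v ncpoly list \<Rightarrow> bool" where
  "asymptotic_RCI m es \<longleftrightarrow> homogeneous_basis m es \<and>
     (\<forall>r > 0. \<forall>N > 0. \<exists>d > N. \<forall>q > 0. koszul_homology_vanishes m es d r q)"

section \<open>The differential is the derivation extending the pullback\<close>

lemma ridx_code_inj: "ridx_code s = ridx_code t \<longleftrightarrow> s = t"
  by (auto simp: ridx_code_def prod_encode_eq split: prod.splits)

lemma koszul_d_eq_sum:
  assumes "finite A" "Poly_Mapping.keys \<xi> \<subseteq> A"
  shows "koszul_d es d \<xi> = (\<Sum>S\<in>A. koszul_d_basis es d S (Poly_Mapping.lookup \<xi> S))"
  unfolding koszul_d_def
  by (rule sum.mono_neutral_left)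
    (use assms in \<open>auto simp: koszul_d_basis_def in_keys_iff\<close>)

lemma koszul_d_basis_add:
  "koszul_d_basis es d S (a + b) = koszul_d_basis es d S a + koszul_d_basis es d S b"
  by (simp add: koszul_d_basis_def algebra_simps single_add sum.distrib)

lemma koszul_d_add: "koszul_d es d (\<xi> + \<eta>) = koszul_d es d \<xi> + koszul_d es d \<eta>"
proof -
  let ?A = "Poly_Mapping.keys \<xi> \<union> Poly_Mapping.keys \<eta>"
  have "Poly_Mapping.keys (\<xi> + \<eta>) \<subseteq> ?A" by (rule keys_add)
  then show ?thesis
    by (simp add: koszul_d_eq_sum[of ?A] lookup_add koszul_d_basis_add sum.distrib)
qed

lemma koszul_d_0 [simp]: "koszul_d es d 0 = 0"
  by (simp add: koszul_d_def)

lemma koszul_d_sum: "koszul_d es d (sum f A) = (\<Sum>x\<in>A. koszul_d es d (f x))"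
  by (induction A rule: infinite_finite_induct) (simp_all add: koszul_d_add)

lemma koszul_d_single: "koszul_d es d (Poly_Mapping.single S c) = koszul_d_basis es d S c"
  by (simp add: koszul_d_eq_sum[of "{S}"])

lemma koszul_d_generator:
  "koszul_d es d (Poly_Mapping.single {s} 1) = Poly_Mapping.single {} (pullback es d s)"
  by (simp add: koszul_d_single koszul_d_basis_def ext_sign_def)

lemma koszul_d_coeff: "koszul_d es d (Poly_Mapping.single {} c) = 0"
  by (simp add: koszul_d_single koszul_d_basis_def)

lemma lookup_ext_scale: "Poly_Mapping.lookup (ext_scale c \<xi>) S = c * Poly_Mapping.lookup \<xi> S"
  by (simp add: ext_scale_def Poly_Mapping.map.rep_eq when_def)

lemma ext_scale_sum: "ext_scale c (sum f A) = (\<Sum>x\<in>A. ext_scale c (f x))"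
  by (rule poly_mapping_eqI) (simp add: lookup_ext_scale lookup_sum sum_distrib_left)

lemma ext_scale_0 [simp]: "ext_scale c 0 = 0"
  by (rule poly_mapping_eqI) (simp add: lookup_ext_scale)

lemma ext_scale_single: "ext_scale c (Poly_Mapping.single S a) = Poly_Mapping.single S (c * a)"
  by (rule poly_mapping_eqI) (simp add: lookup_ext_scale lookup_single when_def)

lemma koszul_d_scale: "koszul_d es d (ext_scale c \<xi>) = ext_scale c (koszul_d es d \<xi>)"
proof -
  have "Poly_Mapping.keys (ext_scale c \<xi>) \<subseteq> Poly_Mapping.keys \<xi>"
    by (auto simp: in_keys_iff lookup_ext_scale)
  then show ?thesis
    by (simp add: koszul_d_eq_sum[of "Poly_Mapping.keys \<xi>"] lookup_ext_scale ext_scale_sum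
        koszul_d_basis_def ext_scale_single mult_ac)
qed

lemma ext_sign_Un_left:
  assumes "finite S" "finite S'" "finite T" "S \<inter> S' = {}"
  shows "ext_sign (S \<union> S') T = ext_sign S T * ext_sign S' T"
proof -
  let ?P = "\<lambda>S. {(s, t). s \<in> S \<and> t \<in> T \<and> ridx_code t < ridx_code s}"
  have fin: "finite (?P U)" if "finite U" for U
    by (rule finite_subset[of _ "U \<times> T"]) (use that assms in auto)
  have "card (?P (S \<union> S')) = card (?P S \<union> ?P S')"
    by (rule arg_cong[where f = card]) auto
  also have "\<dots> = card (?P S) + card (?P S')"
    by (rule card_Un_disjoint) (use assms fin in auto)
  finally show ?thesis by (simp add: ext_sign_def power_add)
qed

lemma ext_sign_Un_right:
  assumes "finite S" "finite T" "finite T'" "T \<inter> T' = {}"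
  shows "ext_sign S (T \<union> T') = ext_sign S T * ext_sign S T'"
proof -
  let ?P = "\<lambda>T. {(s, t). s \<in> S \<and> t \<in> T \<and> ridx_code t < ridx_code s}"
  have fin: "finite (?P U)" if "finite U" for U
    by (rule finite_subset[of _ "S \<times> U"]) (use that assms in auto)
  have "card (?P (T \<union> T')) = card (?P T \<union> ?P T')"
    by (rule arg_cong[where f = card]) auto
  also have "\<dots> = card (?P T) + card (?P T')"
    by (rule card_Un_disjoint) (use assms fin in auto)
  finally show ?thesis by (simp add: ext_sign_def power_add)
qed

lemma ext_sign_sq: "ext_sign S T * ext_sign S T = 1"
  by (simp add: ext_sign_def flip: power_mult_distrib)

lemma ext_sign_swap:
  assumes "finite S" "u \<notin> S"
  shows "ext_sign S {u} * ext_sign {u} S = (-1) ^ card S"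
proof -
  have 1: "card {(s, t). s \<in> S \<and> t \<in> {u} \<and> ridx_code t < ridx_code s}
      = card {s\<in>S. ridx_code u < ridx_code s}"
    by (rule bij_betw_same_card[of fst]) (auto simp: bij_betw_def inj_on_def image_iff)
  have 2: "card {(s, t). s \<in> {u} \<and> t \<in> S \<and> ridx_code t < ridx_code s}
      = card {s\<in>S. ridx_code s < ridx_code u}"
    by (rule bij_betw_same_card[of snd]) (auto simp: bij_betw_def inj_on_def image_iff)
  have "card {s\<in>S. ridx_code u < ridx_code s} + card {s\<in>S. ridx_code s < ridx_code u}
      = card ({s\<in>S. ridx_code u < ridx_code s} \<union> {s\<in>S. ridx_code s < ridx_code u})"
    by (rule card_Un_disjoint[symmetric]) (use assms in auto)
  also have "{s\<in>S. ridx_code u < ridx_code s} \<union> {s\<in>S. ridx_code s < ridx_code u} = S"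
    using assms by (auto, metis ridx_code_inj linorder_neqE_nat)
  finally show ?thesis by (simp only: ext_sign_def 1 2 power_add[symmetric])
qed

lemma wedge_eq_sum:
  assumes "finite A" "Poly_Mapping.keys \<xi> \<subseteq> A" "finite B" "Poly_Mapping.keys \<eta> \<subseteq> B"
  shows "wedge \<xi> \<eta> = (\<Sum>S\<in>A. \<Sum>T\<in>B.
    wedge_basis S T (Poly_Mapping.lookup \<xi> S * Poly_Mapping.lookup \<eta> T))"
proof -
  have "wedge \<xi> \<eta> = (\<Sum>S\<in>Poly_Mapping.keys \<xi>. \<Sum>T\<in>B.
      wedge_basis S T (Poly_Mapping.lookup \<xi> S * Poly_Mapping.lookup \<eta> T))"
    unfolding wedge_def
    by (intro sum.cong refl sum.mono_neutral_left)
      (use assms in \<open>auto simp: wedge_basis_def in_keys_iff\<close>)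
  also have "\<dots> = (\<Sum>S\<in>A. \<Sum>T\<in>B.
      wedge_basis S T (Poly_Mapping.lookup \<xi> S * Poly_Mapping.lookup \<eta> T))"
    by (rule sum.mono_neutral_left)
      (use assms in \<open>auto simp: wedge_basis_def in_keys_iff intro!: sum.neutral\<close>)
  finally show ?thesis .
qed

lemma wedge_basis_add: "wedge_basis S T (a + b) = wedge_basis S T a + wedge_basis S T b"
  by (simp add: wedge_basis_def distrib_left single_add)

lemma wedge_add_left: "wedge (\<xi> + \<xi>') \<eta> = wedge \<xi> \<eta> + wedge \<xi>' \<eta>"
proof -
  let ?A = "Poly_Mapping.keys \<xi> \<union> Poly_Mapping.keys \<xi>'"
  have "Poly_Mapping.keys (\<xi> + \<xi>') \<subseteq> ?A" by (rule keys_add)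
  then show ?thesis
    by (simp add: wedge_eq_sum[of ?A _ "Poly_Mapping.keys \<eta>"] lookup_add distrib_right
        wedge_basis_add sum.distrib)
qed

lemma wedge_add_right: "wedge \<xi> (\<eta> + \<eta>') = wedge \<xi> \<eta> + wedge \<xi> \<eta>'"
proof -
  let ?B = "Poly_Mapping.keys \<eta> \<union> Poly_Mapping.keys \<eta>'"
  have "Poly_Mapping.keys (\<eta> + \<eta>') \<subseteq> ?B" by (rule keys_add)
  then show ?thesis
    by (simp add: wedge_eq_sum[of "Poly_Mapping.keys \<xi>" _ ?B] lookup_add distrib_left
        wedge_basis_add sum.distrib)
qed

lemma wedge_0_left [simp]: "wedge 0 \<eta> = 0"
  by (simp add: wedge_def)

lemma wedge_0_right [simp]: "wedge \<xi> 0 = 0"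
  by (simp add: wedge_def)

lemma wedge_sum_left: "wedge (sum f A) \<eta> = (\<Sum>x\<in>A. wedge (f x) \<eta>)"
  by (induction A rule: infinite_finite_induct) (simp_all add: wedge_add_left)

lemma wedge_sum_right: "wedge \<xi> (sum f A) = (\<Sum>x\<in>A. wedge \<xi> (f x))"
  by (induction A rule: infinite_finite_induct) (simp_all add: wedge_add_right)

lemma wedge_single:
  "wedge (Poly_Mapping.single S a) (Poly_Mapping.single T b) = wedge_basis S T (a * b)"
  by (subst wedge_eq_sum[of "{S}" _ "{T}"]) auto

lemma ext_sum_single: "(\<Sum>S\<in>Poly_Mapping.keys \<xi>. Poly_Mapping.single S (Poly_Mapping.lookup \<xi> S)) = \<xi>"
  by (rule poly_mapping_eqI)
    (simp add: lookup_sum lookup_single when_def in_keys_iff)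

lemma koszul_d_wedge_single:
  fixes a b :: "'v cpoly"
  assumes S: "finite S" and T: "finite T"
  defines "x \<equiv> Poly_Mapping.single S a" and "y \<equiv> Poly_Mapping.single T b"
  shows "koszul_d es d (wedge x y) =
    wedge (koszul_d es d x) y + ext_scale ((-1) ^ card S) (wedge x (koszul_d es d y))"
proof -
  let ?F = "pullback es d :: ridx \<Rightarrow> 'v cpoly"
  let ?\<sigma> = "ext_sign :: ridx set \<Rightarrow> ridx set \<Rightarrow> 'v cpoly"
  define l where "l u = wedge_basis (S - {u}) T (?\<sigma> {u} (S - {u}) * ?F u * a * b)" for u
  define r where "r u =
    ext_scale ((-1) ^ card S) (wedge_basis S (T - {u}) (a * (?\<sigma> {u} (T - {u}) * ?F u * b)))" for u
  have L: "wedge (koszul_d es d x) y = (\<Sum>u\<in>S. l u)"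
    by (simp add: x_def y_def koszul_d_single koszul_d_basis_def wedge_sum_left wedge_single l_def)
  have R: "ext_scale ((-1) ^ card S) (wedge x (koszul_d es d y)) = (\<Sum>u\<in>T. r u)"
    by (simp add: x_def y_def koszul_d_single koszul_d_basis_def wedge_sum_right wedge_single r_def
        ext_scale_sum)
  have left: "?\<sigma> S U = ?\<sigma> {u} U * ?\<sigma> (S - {u}) U" if "u \<in> S" "finite U" for u U
    using ext_sign_Un_left[of "{u}" "S - {u}" U] that S by (simp add: insert_absorb)
  have right: "?\<sigma> U T = ?\<sigma> U {u} * ?\<sigma> U (T - {u})" if "u \<in> T" "finite U" for u U
    using ext_sign_Un_right[of U "{u}" "T - {u}"] that T by (simp add: insert_absorb)
  show ?thesis
  proof (cases "S \<inter> T = {}")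
    case True
    define t where "t u = Poly_Mapping.single (S \<union> T - {u})
      (?\<sigma> {u} (S \<union> T - {u}) * ?F u * (?\<sigma> S T * (a * b)))" for u
    have lt: "l u = t u" if u: "u \<in> S" for u
    proof -
      have eq: "S \<union> T - {u} = (S - {u}) \<union> T" using u True by auto
      have "?\<sigma> {u} (S \<union> T - {u}) = ?\<sigma> {u} (S - {u}) * ?\<sigma> {u} T"
        unfolding eq by (rule ext_sign_Un_right) (use S T True in auto)
      then have "?\<sigma> {u} (S \<union> T - {u}) * ?\<sigma> S T =
          ?\<sigma> (S - {u}) T * ?\<sigma> {u} (S - {u}) * (?\<sigma> {u} T * ?\<sigma> {u} T)"
        by (simp only: left[OF u T] mult_ac)
      then have c: "?\<sigma> {u} (S \<union> T - {u}) * ?\<sigma> S T = ?\<sigma> (S - {u}) T * ?\<sigma> {u} (S - {u})"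
        by (simp only: ext_sign_sq mult_1_right)
      have "l u = Poly_Mapping.single (S \<union> T - {u})
          ((?\<sigma> (S - {u}) T * ?\<sigma> {u} (S - {u})) * (?F u * a * b))"
        unfolding l_def wedge_basis_def using True eq by (auto simp: mult_ac)
      then show ?thesis by (simp only: t_def c[symmetric] mult_ac)
    qed
    have rt: "r u = t u" if u: "u \<in> T" for u
    proof -
      have eq: "S \<union> T - {u} = S \<union> (T - {u})" and uS: "u \<notin> S" using u True by auto
      have "?\<sigma> {u} (S \<union> T - {u}) = ?\<sigma> {u} S * ?\<sigma> {u} (T - {u})"
        unfolding eq by (rule ext_sign_Un_right) (use S T True in auto)
      then have "?\<sigma> {u} (S \<union> T - {u}) * ?\<sigma> S T =
          (?\<sigma> S {u} * ?\<sigma> {u} S) * (?\<sigma> S (T - {u}) * ?\<sigma> {u} (T - {u}))"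
        by (simp only: right[OF u S] mult_ac)
      then have c: "?\<sigma> {u} (S \<union> T - {u}) * ?\<sigma> S T =
          (-1) ^ card S * (?\<sigma> S (T - {u}) * ?\<sigma> {u} (T - {u}))"
        by (simp only: ext_sign_swap[OF S uS])
      have "r u = Poly_Mapping.single (S \<union> T - {u})
          (((-1) ^ card S * (?\<sigma> S (T - {u}) * ?\<sigma> {u} (T - {u}))) * (?F u * (a * b)))"
        unfolding r_def wedge_basis_def using True eq by (auto simp: ext_scale_single mult_ac)
      then show ?thesis by (simp only: t_def c[symmetric] mult_ac)
    qed
    have "koszul_d es d (wedge x y) = (\<Sum>u\<in>S \<union> T. t u)"
      using True by (simp add: x_def y_def wedge_single wedge_basis_def koszul_d_single
          koszul_d_basis_def t_def)
    also have "\<dots> = (\<Sum>u\<in>S. t u) + (\<Sum>u\<in>T. t u)"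
      by (rule sum.union_disjoint) (use S T True in auto)
    also have "\<dots> = (\<Sum>u\<in>S. l u) + (\<Sum>u\<in>T. r u)"
      by (simp add: lt rt)
    finally show ?thesis by (simp only: L R)
  next
    case False
    have "koszul_d es d (wedge x y) = 0"
      using False by (simp add: x_def y_def wedge_single wedge_basis_def)
    moreover have "(\<Sum>u\<in>S. l u) + (\<Sum>u\<in>T. r u) = 0"
    proof -
      have l0: "l u = 0" if "u \<in> S - S \<inter> T" for u
        using that False by (auto simp: l_def wedge_basis_def)
      have r0: "r u = 0" if "u \<in> T - S \<inter> T" for u
        using that False by (auto simp: r_def wedge_basis_def)
      have "l u + r u = 0" if u: "u \<in> S \<inter> T" for u
      proof (cases "S \<inter> T = {u}")
        case eq: True
        have 1: "(S - {u}) \<inter> T = {}" "S \<inter> (T - {u}) = {}" and 2: "(S - {u}) \<union> T = S \<union> T"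
          "S \<union> (T - {u}) = S \<union> T" using eq by auto
        have uS: "u \<in> S" and uT: "u \<in> T" using u by auto
        have card: "(-1::'v cpoly) ^ card S = - ((-1) ^ card (S - {u}))"
          using S uS by (subst card.remove) auto
        have sw: "?\<sigma> (S - {u}) {u} * ?\<sigma> {u} (S - {u}) = (-1) ^ card (S - {u})"
          by (rule ext_sign_swap) (use S in auto)
        have sq: "?\<sigma> {u} (T - {u}) * ?\<sigma> {u} (T - {u}) = 1" by (rule ext_sign_sq)
        define C where "C = ?\<sigma> (S - {u}) (T - {u}) * ?F u * a * b"
        have "?\<sigma> (S - {u}) T * (?\<sigma> {u} (S - {u}) * ?F u * a * b) =
            (?\<sigma> (S - {u}) {u} * ?\<sigma> {u} (S - {u})) * C"
          using right[OF uT, of "S - {u}"] S by (simp add: C_def mult_ac)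
        then have "l u = Poly_Mapping.single (S \<union> T) ((-1) ^ card (S - {u}) * C)"
          by (simp add: l_def wedge_basis_def 1 2 sw)
        moreover have "?\<sigma> S (T - {u}) * (a * (?\<sigma> {u} (T - {u}) * ?F u * b)) =
            (?\<sigma> {u} (T - {u}) * ?\<sigma> {u} (T - {u})) * C"
          using left[OF uS, of "T - {u}"] T by (simp add: C_def mult_ac)
        then have "r u = Poly_Mapping.single (S \<union> T) ((-1) ^ card S * C)"
          by (simp add: r_def wedge_basis_def 1 2 sq ext_scale_single)
        ultimately show ?thesis by (simp add: card flip: single_add)
      next
        case False
        then show ?thesis using u
          by (auto simp: l_def r_def wedge_basis_def)
      qed
      then have "(\<Sum>u\<in>S \<inter> T. l u) + (\<Sum>u\<in>S \<inter> T. r u) = 0"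
        by (simp flip: sum.distrib)
      moreover have "(\<Sum>u\<in>S. l u) = (\<Sum>u\<in>S \<inter> T. l u)"
        by (rule sum.mono_neutral_right) (use S l0 in auto)
      moreover have "(\<Sum>u\<in>T. r u) = (\<Sum>u\<in>S \<inter> T. r u)"
        by (rule sum.mono_neutral_right) (use T r0 in auto)
      ultimately show ?thesis by simp
    qed
    ultimately show ?thesis by (simp only: L R)
  qed
qed

lemma koszul_d_wedge:
  assumes "\<xi> \<in> ext_deg p" "\<eta> \<in> ext_deg q"
  shows "koszul_d es d (wedge \<xi> \<eta>) =
    wedge (koszul_d es d \<xi>) \<eta> + ext_scale ((-1) ^ p) (wedge \<xi> (koszul_d es d \<eta>))"
proof -
  define x where "x S = Poly_Mapping.single S (Poly_Mapping.lookup \<xi> S)" for S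
  define y where "y T = Poly_Mapping.single T (Poly_Mapping.lookup \<eta> T)" for T
  define A B where "A = Poly_Mapping.keys \<xi>" and "B = Poly_Mapping.keys \<eta>"
  have 1: "\<xi> = (\<Sum>S\<in>A. x S)" "\<eta> = (\<Sum>T\<in>B. y T)"
    by (simp_all add: x_def y_def A_def B_def ext_sum_single)
  have 2: "koszul_d es d (wedge (x S) (y T)) = wedge (koszul_d es d (x S)) (y T) +
      ext_scale ((-1) ^ p) (wedge (x S) (koszul_d es d (y T)))" if "S \<in> A" "T \<in> B" for S T
    using koszul_d_wedge_single[of S T es d "Poly_Mapping.lookup \<xi> S" "Poly_Mapping.lookup \<eta> T"]
      assms that by (auto simp: ext_deg_def x_def y_def A_def B_def)
  have "koszul_d es d (wedge \<xi> \<eta>) = (\<Sum>S\<in>A. \<Sum>T\<in>B. koszul_d es d (wedge (x S) (y T)))"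
    by (simp only: 1 wedge_sum_left koszul_d_sum) (simp only: wedge_sum_right koszul_d_sum)
  also have "\<dots> = (\<Sum>S\<in>A. \<Sum>T\<in>B. wedge (koszul_d es d (x S)) (y T)) +
      ext_scale ((-1) ^ p) (\<Sum>S\<in>A. \<Sum>T\<in>B. wedge (x S) (koszul_d es d (y T)))"
    by (simp add: 2 sum.distrib ext_scale_sum cong: sum.cong)
  also have "(\<Sum>S\<in>A. \<Sum>T\<in>B. wedge (koszul_d es d (x S)) (y T)) = wedge (koszul_d es d \<xi>) \<eta>"
    by (simp only: 1 wedge_sum_left koszul_d_sum) (simp only: wedge_sum_right koszul_d_sum)
  also have "(\<Sum>S\<in>A. \<Sum>T\<in>B. wedge (x S) (koszul_d es d (y T))) = wedge \<xi> (koszul_d es d \<eta>)"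
    by (simp only: 1 wedge_sum_left koszul_d_sum) (simp only: wedge_sum_right koszul_d_sum)
  finally show ?thesis .
qed

end

theory Submission
  imports Defs
begin

text \<open>No two of the words are cyclic rotations of each other, so \<open>L \<inter> [TV, TV] = 0\<close> and one has to
  show that the matrix entries \<open>\<Sum> x\<^bsub>i n\<^sub>1\<^esub> x\<^bsub>n\<^sub>1 n\<^sub>2\<^esub> \<dots> x\<^bsub>n\<^sub>l j\<^esub>\<close> of the relations behave like a regular sequence
  in weight at most \<open>r\<close>. Every basis element of the Koszul complex gets a key such that the
  differential is a leading part, which preserves the key, plus terms of smaller key.

  Each matrix index carries a slot \<open>(a, t)\<close>, position \<open>t\<close> in the relation \<open>e\<^sub>a\<close>, and the key first counts
  the edges \<open>(k, i, j)\<close> compatible with the slots. As the words do not overlap, the paths for \<open>e\<^sub>a\<close> all of whose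
  edges are compatible are exactly those running through the slots \<open>(a, 1), (a, 2), \<dots>\<close> in order, so that the surviving
  parts of different relations involve different variables. In weight at most \<open>r\<close> a basis element meets
  at most \<open>2 r\<close> external indices \<open>i, j\<close>, and the leading differential preserves their set \<open>T\<close>. If \<open>d\<close> is
  large, one can choose for each \<open>e\<^sub>a\<close> and \<open>i, j \<in> T\<close> one path such that the resulting monomials are pairwise
  coprime; the key secondly counts edges of these paths, which leaves exactly these
  monomials as leading terms. The Koszul complex of pairwise coprime monomials has an explicit
  contraction, and it is a contraction of the original complex up to smaller key.\<close>

section \<open>Words without overlaps\<close>

locale nonoverlapping_words =
  fixes es :: "'v list list"
  assumes distinct_es: "distinct es"
    and nonoverlapping_es: "e \<in> set es \<Longrightarrow> f \<in> set es \<Longrightarrow> nonoverlapping e f"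
begin

abbreviation len :: "nat \<Rightarrow> nat" where "len a \<equiv> length (es ! a)"

lemma nonoverlapping_nth: "a < length es \<Longrightarrow> b < length es \<Longrightarrow> nonoverlapping (es ! a) (es ! b)"
  by (simp add: nonoverlapping_es)

lemma len_pos: "a < length es \<Longrightarrow> 0 < len a"
  using nonoverlapping_nth[of a a] by (simp add: nonoverlapping_def)

lemma sublist_nth_eq:
  assumes "a < length es" "b < length es" "sublist (es ! a) (es ! b)"
  shows "a = b"
  using assms nonoverlapping_nth[of a b] distinct_es
  by (auto simp: nonoverlapping_def strict_sublist_def nth_eq_iff_index_eq)

lemma prefix_suffix_nth_eq:
  assumes "a < length es" "b < length es" "u \<noteq> []" "prefix u (es ! a)" "suffix u (es ! b)"
  shows "a = b" "u = es ! a"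
  using assms nonoverlapping_nth[of a b] distinct_es
  by (auto simp: nonoverlapping_def nth_eq_iff_index_eq)

section \<open>Special edges\<close>

text \<open>The code of a node is decoded twice: its first component is the slot, its second a free
  label, so that every slot belongs to infinitely many nodes.\<close>

definition slot :: "nat \<Rightarrow> nat \<times> nat" where
  "slot n = prod_decode (fst (prod_decode n))"

text \<open>The first and last node of a path for the relation \<open>a\<close> are arbitrary indices, which may themselves
  have any slot; hence the guards.\<close>

definition special_at :: "nat \<Rightarrow> nat \<Rightarrow> 'v \<times> nat \<times> nat \<Rightarrow> bool" where
  "special_at a t = (\<lambda>(k, i, j). a < length es \<and> t < len a \<and> es ! a ! t = k \<and>
     (0 < t \<longrightarrow> slot i = (a, t)) \<and> (Suc t < len a \<longrightarrow> slot j = (a, Suc t)))"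

definition special :: "'v \<times> nat \<times> nat \<Rightarrow> bool" where
  "special x \<longleftrightarrow> (\<exists>a t. special_at a t x)"

text \<open>By symmetry take \<open>t \<le> t'\<close>. If \<open>0 < t\<close>, the slot of the
  source node decides. If \<open>t = 0 < t'\<close>, a common target slot would force
  \<open>t' = 0\<close>, so one of the positions is the last in its word; then \<open>k\<close> is
  both a prefix and a suffix, or a one-letter relation inside another, which is impossible. If both
  positions are 0, two longer words share the target slot, and a one-letter word is a subword of the
  other, hence equal to it.\<close>

lemma special_at_unique:
  assumes "special_at a t x" "special_at a' t' x"
  shows "a = a'" "t = t'"
proof -
  have *: "a = a' \<and> t = t'" if sp: "special_at a t x" "special_at a' t' x" and le: "t \<le> t'" for a t a' t'
  proof (cases "t' = 0")
    case False
    obtain k i j where x: "x = (k, i, j)" by (cases x)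
    have lt: "a < length es" "t < len a" "a' < length es" "t' < len a'"
      and k: "es ! a ! t = k" "es ! a' ! t' = k"
      using sp by (auto simp: special_at_def x)
    show ?thesis
    proof (cases "t = 0")
      case t0: True
      have "prefix [k] (es ! a)" using k lt t0
        by (cases "es ! a") auto
      moreover have "sublist [k] (es ! a')"
        using k(2) lt(4) by (metis id_take_nth_drop sublist_appendI append_Cons append_Nil)
      moreover have "suffix [k] (es ! a')" if "Suc t' = len a'"
        using that k(2) lt(4) by (metis append_butlast_last_id last_conv_nth diff_Suc_1 list.size(3) nat.distinct(1) suffix_def)
      ultimately show ?thesis
      proof -
        assume pre: "prefix [k] (es ! a)" and sub: "sublist [k] (es ! a')"
          and suf: "Suc t' = len a' \<Longrightarrow> suffix [k] (es ! a')"
        show ?thesis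
        proof (cases "Suc t' = len a'")
          case True
          have "a = a'" "[k] = es ! a"
            using prefix_suffix_nth_eq[OF lt(1,3) _ pre suf[OF True]] by auto
          then show ?thesis using lt False by (metis length_Cons list.size(3) less_Suc0)
        next
          case nl: False
          show ?thesis
          proof (cases "Suc t < len a")
            case True
            then show ?thesis using sp nl lt False t0 by (auto simp: special_at_def x)
          next
            case l: False
            then have "es ! a = [k]" using t0 k lt
              by (cases "es ! a") auto
            then have "a = a'" using sublist_nth_eq[OF lt(1,3)] sub by auto
            then show ?thesis using l nl lt t0 False by auto
          qed
        qed
      qed
    next
      case t1: False
      then show ?thesis using sp False by (auto simp: special_at_def x)
    qed
  next
    case True
    then have t: "t = 0" "t' = 0" using le by auto
    obtain k i j where x: "x = (k, i, j)" by (cases x)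
    have lt: "a < length es" "t < len a" "a' < length es" "t' < len a'"
      and k: "es ! a ! t = k" "es ! a' ! t' = k"
      using sp by (auto simp: special_at_def x)
    have single: "es ! b = [k]" if "b < length es" "es ! b ! 0 = k" "\<not> Suc 0 < len b" for b
      using that len_pos[of b] by (cases "es ! b") auto
    have hd: "sublist [k] (es ! b)" if "b < length es" "es ! b ! 0 = k" for b
      using that len_pos[of b] by (cases "es ! b") (auto simp: sublist_def intro: exI[of _ "[]"])
    show ?thesis
      using sp sublist_nth_eq[of a a'] sublist_nth_eq[of a' a] single[of a] single[of a'] hd[of a] hd[of a'] lt k t
      by (cases "Suc 0 < len a"; cases "Suc 0 < len a'") (auto simp: special_at_def x)
  qed
  have "a = a' \<and> t = t'"
    using *[OF assms] *[OF assms(2,1)] linear[of t t'] by metis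
  then show "a = a'" "t = t'" by simp_all
qed

definition edge :: "nat \<Rightarrow> (nat \<Rightarrow> nat) \<Rightarrow> nat \<Rightarrow> 'v \<times> nat \<times> nat" where
  "edge a f t = (es ! a ! t, f t, f (Suc t))"

text \<open>A walk reading the word \<open>a\<close> along special edges is cut into segments of relations. A segment that
  completes a relation too early, or a last segment other than the whole word, would give an overlap.\<close>

lemma special_walk:
  assumes a: "a < length es" and sp: "\<And>t. t < len a \<Longrightarrow> special (edge a f t)"
    and t: "t < len a"
  shows "special_at a t (edge a f t)"
proof -
  have "\<forall>t. \<exists>bp. t < len a \<longrightarrow> special_at (fst bp) (snd bp) (edge a f t)"
    using sp by (auto simp: special_def)
  then obtain g where g: "\<And>t. t < len a \<Longrightarrow> special_at (fst (g t)) (snd (g t)) (edge a f t)"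
    by metis
  \<comment> \<open>\<open>A t\<close> and \<open>P t\<close> are the relation and the position to
    which edge number \<open>t\<close> of the walk belongs.\<close>
  define A P where "A = fst \<circ> g" and "P = snd \<circ> g"
  have AP: "special_at (A t) (P t) (edge a f t)" if "t < len a" for t
    using g that by (simp add: A_def P_def)
  have Ab: "A t < length es" "P t < len (A t)" "es ! A t ! P t = es ! a ! t" if "t < len a" for t
    using AP[OF that] by (auto simp: special_at_def edge_def)
  \<comment> \<open>\<open>R t s\<close>: the edges from \<open>s\<close> to \<open>t\<close> form
    one segment, at consecutive positions of a single relation, which starts with the walk or with
    that relation.\<close>
  define R where "R t s \<longleftrightarrow> s \<le> t \<and> (s = 0 \<or> P s = 0) \<and>
     (\<forall>u. s \<le> u \<and> u \<le> t \<longrightarrow> A u = A t \<and> P u + (t - u) = P t)" for t s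
  have RU: "s \<le> t \<and> (s = 0 \<or> P s = 0) \<and>
      (\<forall>u. s \<le> u \<and> u \<le> t \<longrightarrow> A u = A t \<and> P u + (t - u) = P t)" if "R t s" for t s
    using that unfolding R_def .
  note Rs = RU[THEN conjunct1] RU[THEN conjunct2, THEN conjunct1]
  have Ru: "A u = A t" "P u + (t - u) = P t" if "R t s" "s \<le> u" "u \<le> t" for t s u
    using RU[OF that(1), THEN conjunct2, THEN conjunct2, rule_format, OF conjI[OF that(2,3)]]
    by (rule conjunct1, rule conjunct2)
  have seg: "drop s (take (Suc t) (es ! a)) = drop (P s) (take (Suc (P t)) (es ! A t))"
    if "R t s" "t < len a" for t s
  proof (rule nth_equalityI)
    have "P s + (t - s) = P t" "s \<le> t" using Rs[OF that(1)] Ru[OF that(1)] by auto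
    then show "length (drop s (take (Suc t) (es ! a))) = length (drop (P s) (take (Suc (P t)) (es ! A t)))"
      using that(2) Ab(2)[OF that(2)] by (auto simp: min_def)
    fix v assume "v < length (drop s (take (Suc t) (es ! a)))"
    then have v: "s + v \<le> t" using that by auto
    have "A (s + v) = A t" "P (s + v) + (t - (s + v)) = P t" "P s + (t - s) = P t"
      using Ru[OF that(1), of "s + v"] Ru[OF that(1), of s] v by auto
    then have "A (s + v) = A t" "P (s + v) = P s + v" "P s + v \<le> P t" using v by auto
    then show "drop s (take (Suc t) (es ! a)) ! v = drop (P s) (take (Suc (P t)) (es ! A t)) ! v"
      using v Ab(2)[OF that(2)] Ab(3)[of "s + v"] that(2)
      by auto
  qed
  \<comment> \<open>A relation completed before the end of the walk overlaps with
    \<open>es ! a\<close>: for \<open>s = 0\<close> a suffix of it is a proper prefix of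
    \<open>es ! a\<close>, otherwise all of it lies properly inside \<open>es ! a\<close>.\<close>
  have nl: False if "R t s" "Suc t < len a" "Suc (P t) = len (A t)" for t s
  proof -
    have tl: "t < len a" using that by simp
    have e: "drop s (take (Suc t) (es ! a)) = drop (P s) (es ! A t)"
      using seg[OF that(1) tl] that(3) by simp
    show False
    proof (cases "s = 0")
      case True
      have "take (Suc t) (es ! a) = es ! a"
      proof (rule prefix_suffix_nth_eq(2)[OF a Ab(1)[OF tl]])
        show "take (Suc t) (es ! a) \<noteq> []" using tl by (cases "es ! a") auto
        show "prefix (take (Suc t) (es ! a)) (es ! a)" by (rule take_is_prefix)
        show "suffix (take (Suc t) (es ! a)) (es ! A t)" using e True
          by (metis drop0 suffix_drop)
      qed
      then show False using that(2) by (metis length_take min.absorb4 nat_less_le)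
    next
      case False
      then have "P s = 0" using Rs[OF that(1)] by simp
      then have e': "drop s (take (Suc t) (es ! a)) = es ! A t" using e by simp
      have "sublist (es ! A t) (es ! a)"
        unfolding e'[symmetric]
        by (meson sublist_drop sublist_take sublist_order.order_trans)
      then have "A t = a" using sublist_nth_eq Ab(1)[OF tl] a by blast
      then have "len a = Suc t - s" using arg_cong[OF e', of length] tl by auto
      then show False using that(2) by simp
    qed
  qed
  \<comment> \<open>As the relation at \<open>t\<close> is not completed, the slot of the node
    between two edges says that the next edge continues it, unless that edge starts a
    relation.\<close>
  have R: "\<exists>s. R t s" if "t < len a" for t
    using that
  proof (induction t)
    case 0
    then show ?case by (auto simp: R_def)
  next
    case (Suc t)
    then obtain s where s: "R t s" by auto
    have nlast: "Suc (P t) < len (A t)"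
      using nl[OF s Suc.prems] Ab(2)[of t] Suc.prems by fastforce
    show ?case
    proof (cases "P (Suc t) = 0")
      case True
      then show ?thesis by (intro exI[of _ "Suc t"]) (auto simp: R_def)
    next
      case False
      have "slot (f (Suc t)) = (A t, Suc (P t))"
        using AP[of t] Suc.prems nlast by (auto simp: special_at_def edge_def)
      moreover have "slot (f (Suc t)) = (A (Suc t), P (Suc t))"
        using AP[of "Suc t"] Suc.prems False by (auto simp: special_at_def edge_def)
      ultimately have "A (Suc t) = A t" "P (Suc t) = Suc (P t)" by auto
      then have "A u = A (Suc t) \<and> P u + (Suc t - u) = P (Suc t)" if "s \<le> u \<and> u \<le> Suc t" for u
        using Ru[OF s, of u] that by (cases "u = Suc t") auto
      then have *: "\<forall>u. s \<le> u \<and> u \<le> Suc t \<longrightarrow> A u = A (Suc t) \<and> P u + (Suc t - u) = P (Suc t)"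
        by (intro allI impI)
      have "s \<le> Suc t" using Rs[OF s] by simp
      then show ?thesis unfolding R_def by (intro exI[of _ s] conjI Rs(2)[OF s] *)
    qed
  qed
  define l where "l = len a - 1"
  have l: "l < len a" "Suc l = len a" using len_pos[OF a] by (auto simp: l_def)
  obtain s where s: "R l s" using R l by blast
  have e: "drop s (es ! a) = drop (P s) (take (Suc (P l)) (es ! A l))"
    using seg[OF s l(1)] l by simp
  have sl: "s \<le> l" using Rs[OF s] by simp
  \<comment> \<open>The last segment is the whole word: for \<open>s = 0\<close> the word lies
    inside the relation \<open>A l\<close>, and for \<open>0 < s\<close> a proper suffix of it would
    begin that relation.\<close>
  have "A l = a \<and> s = 0 \<and> P s = 0"
  proof (cases "s = 0")
    case True
    have "sublist (es ! a) (es ! A l)"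
      using e True by (metis drop0 sublist_drop sublist_take sublist_order.order_trans)
    then have Al: "A l = a" using sublist_nth_eq Ab(1)[OF l(1)] a by blast
    moreover have "P s + l = P l" using Ru(2)[OF s, of 0] True by simp
    ultimately show ?thesis using True Ab(2)[OF l(1)] l by auto
  next
    case False
    then have P0: "P s = 0" using Rs[OF s] by simp
    have *: "drop s (es ! a) = take (Suc (P l)) (es ! A l)" using e P0 by simp
    have "drop s (es ! a) \<noteq> []" using sl l by simp
    moreover have "prefix (drop s (es ! a)) (es ! A l)" unfolding * by (rule take_is_prefix)
    ultimately have eq: "A l = a" "drop s (es ! a) = es ! A l"
      using prefix_suffix_nth_eq[OF Ab(1)[OF l(1)] a, of "drop s (es ! a)"] suffix_drop by blast+
    have "len a - s = len a" using arg_cong[OF eq(2), of length] by (simp add: eq(1))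
    then show ?thesis using False l by linarith
  qed
  then have "A t = a" "P t + (l - t) = l"
    using Ru[OF s, of t] Ru[OF s, of 0] t l sl by auto
  then have "A t = a" "P t = t" using t l by auto
  then show ?thesis using AP[OF t] by simp
qed

end

section \<open>Weights of exponents\<close>

text \<open>One function serves twice: \<open>g = m \<circ> fst\<close> gives the weight of a
  monomial, the indicator of an edge set gives the number of its edges counted with
  multiplicity.\<close>

definition wt :: "('x \<Rightarrow> nat) \<Rightarrow> ('x \<Rightarrow>\<^sub>0 nat) \<Rightarrow> nat" where
  "wt g \<alpha> = (\<Sum>x\<in>Poly_Mapping.keys \<alpha>. Poly_Mapping.lookup \<alpha> x * g x)"

lemma wt_eq_sum:
  assumes "finite A" "Poly_Mapping.keys \<alpha> \<subseteq> A"
  shows "wt g \<alpha> = (\<Sum>x\<in>A. Poly_Mapping.lookup \<alpha> x * g x)"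
  unfolding wt_def by (rule sum.mono_neutral_left) (use assms in \<open>auto simp: in_keys_iff\<close>)

lemma wt_add: "wt g (\<alpha> + \<beta>) = wt g \<alpha> + wt g \<beta>"
proof -
  let ?A = "Poly_Mapping.keys \<alpha> \<union> Poly_Mapping.keys \<beta>"
  have "Poly_Mapping.keys (\<alpha> + \<beta>) \<subseteq> ?A" by (rule keys_add)
  then show ?thesis
    by (simp add: wt_eq_sum[of ?A] lookup_add distrib_right sum.distrib)
qed

lemma wt_0 [simp]: "wt g 0 = 0"
  by (simp add: wt_def)

lemma wt_single [simp]: "wt g (Poly_Mapping.single x n) = n * g x"
  by (simp add: wt_eq_sum[of "{x}"])

lemma wt_sum: "wt g (sum f A) = (\<Sum>x\<in>A. wt g (f x))"
  by (induction A rule: infinite_finite_induct) (simp_all add: wt_add)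

lemma wt_le: "(\<And>x. g x \<le> g' x) \<Longrightarrow> wt g \<alpha> \<le> wt g' \<alpha>"
  unfolding wt_def by (intro sum_mono mult_left_mono) auto

lemma card_keys_le_wt:
  assumes "\<And>x. 0 < g x"
  shows "card (Poly_Mapping.keys \<alpha>) \<le> wt g \<alpha>"
proof -
  have "card (Poly_Mapping.keys \<alpha>) = (\<Sum>x\<in>Poly_Mapping.keys \<alpha>. 1)" by simp
  also have "\<dots> \<le> wt g \<alpha>"
    unfolding wt_def using assms by (intro sum_mono) (auto simp: in_keys_iff Suc_le_eq)
  finally show ?thesis .
qed

lemma keys_add_nat:
  fixes \<alpha> \<beta> :: "'x \<Rightarrow>\<^sub>0 nat"
  shows "Poly_Mapping.keys (\<alpha> + \<beta>) = Poly_Mapping.keys \<alpha> \<union> Poly_Mapping.keys \<beta>"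
  by (auto simp: in_keys_iff lookup_add)

lemma keys_sum_nat:
  fixes f :: "'i \<Rightarrow> 'x \<Rightarrow>\<^sub>0 nat"
  assumes "finite A"
  shows "Poly_Mapping.keys (sum f A) = (\<Union>i\<in>A. Poly_Mapping.keys (f i))"
  using assms by induction (simp_all add: keys_add_nat)

section \<open>Ranks and leading paths\<close>

definition rank :: "nat set \<Rightarrow> nat \<Rightarrow> nat" where
  "rank T i = card {i' \<in> T. i' < i}"

lemma rank_less_card: "finite T \<Longrightarrow> i \<in> T \<Longrightarrow> rank T i < card T"
  unfolding rank_def by (rule psubset_card_mono) auto

lemma rank_strict_mono: "finite T \<Longrightarrow> i \<in> T \<Longrightarrow> i < j \<Longrightarrow> rank T i < rank T j"
  unfolding rank_def by (rule psubset_card_mono) auto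

lemma rank_eq_iff: "finite T \<Longrightarrow> i \<in> T \<Longrightarrow> j \<in> T \<Longrightarrow> rank T i = rank T j \<longleftrightarrow> i = j"
  by (metis linorder_neqE_nat nat_neq_iff rank_strict_mono)

text \<open>Laid out so that \<open>slot\<close> returns \<open>(a, t)\<close>; the label
  \<open>(p, q)\<close> keeps apart nodes with the same slot.\<close>

definition inner_node :: "nat \<Rightarrow> nat \<Rightarrow> nat \<Rightarrow> nat \<Rightarrow> nat" where
  "inner_node a t p q = prod_encode (prod_encode (a, t), prod_encode (p, q))"

lemma inner_node_eq_iff [simp]:
  "inner_node a t p q = inner_node a' t' p' q' \<longleftrightarrow> a = a' \<and> t = t' \<and> p = p' \<and> q = q'"
  by (auto simp: inner_node_def prod_encode_eq)

context nonoverlapping_words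
begin

lemma slot_inner_node [simp]: "slot (inner_node a t p q) = (a, t)"
  by (simp add: slot_def inner_node_def)

definition path_exp :: "nat \<Rightarrow> (nat \<Rightarrow> nat) \<Rightarrow> ('v \<times> nat \<times> nat) \<Rightarrow>\<^sub>0 nat" where
  "path_exp a f = (\<Sum>t<len a. Poly_Mapping.single (edge a f t) 1)"

lemma keys_path_exp: "Poly_Mapping.keys (path_exp a f) = edge a f ` {..<len a}"
  by (auto simp: path_exp_def keys_sum_nat)

lemma wt_path_exp: "wt g (path_exp a f) = (\<Sum>t<len a. g (edge a f t))"
  by (simp add: path_exp_def wt_sum)

text \<open>The indices \<open>i\<close> and \<open>j\<close> are recorded in every inner node, which makes the monomials of these paths pairwise
  coprime; their ranks rather than their values are used because \<open>d\<close> inner nodes must suffice.\<close>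

definition lead_nodes :: "nat set \<Rightarrow> ridx \<Rightarrow> nat \<Rightarrow> nat" where
  "lead_nodes T = (\<lambda>(a, i, j) t. if t = 0 then i else if t = len a then j
     else inner_node a t (rank T i) (rank T j))"

abbreviation lead_edge :: "nat set \<Rightarrow> ridx \<Rightarrow> nat \<Rightarrow> 'v \<times> nat \<times> nat" where
  "lead_edge T s \<equiv> edge (fst s) (lead_nodes T s)"

definition lead_exp :: "nat set \<Rightarrow> ridx \<Rightarrow> ('v \<times> nat \<times> nat) \<Rightarrow>\<^sub>0 nat" where
  "lead_exp T s = path_exp (fst s) (lead_nodes T s)"

lemma special_at_lead_edge:
  assumes "fst s < length es" "t < len (fst s)"
  shows "special_at (fst s) t (lead_edge T s t)"
  using assms by (auto simp: special_at_def edge_def lead_nodes_def split: prod.splits)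

definition relations :: "nat set \<Rightarrow> ridx set" where
  "relations T = {..<length es} \<times> T \<times> T"

text \<open>By \<open>special_at_unique\<close> an edge determines its relation and position. The
  indices \<open>i\<close> and \<open>j\<close> are then visible at its nodes, either directly at an
  end of the path or as ranks in an inner node, and ranks are injective on \<open>T\<close>.\<close>

lemma lead_edge_inj:
  assumes T: "finite T" and s: "s \<in> relations T" "s' \<in> relations T"
    and t: "t < len (fst s)" "t' < len (fst s')" and eq: "lead_edge T s t = lead_edge T s' t'"
  shows "s = s'" "t = t'"
proof -
  obtain a i j a' i' j' where ss: "s = (a, i, j)" "s' = (a', i', j')"
    by (cases s, cases s')
  have *: "a = a'" "t = t'"
    using special_at_unique[OF special_at_lead_edge[of s t T]] special_at_lead_edge[of s' t' T]
      s t eq by (auto simp: ss relations_def)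
  with s t eq rank_eq_iff[OF T] have "i = i' \<and> j = j'"
    by (auto simp: ss relations_def edge_def lead_nodes_def split: if_splits)
  then show "s = s'" "t = t'" by (simp_all add: ss *)
qed

lemma lead_exp_coprime:
  assumes "finite T" "s \<in> relations T" "s' \<in> relations T" "s \<noteq> s'"
    "x \<in> Poly_Mapping.keys (lead_exp T s)"
  shows "x \<notin> Poly_Mapping.keys (lead_exp T s')"
  using assms lead_edge_inj(1)[OF assms(1-3)] by (auto simp: lead_exp_def keys_path_exp)

definition lead_edges :: "nat set \<Rightarrow> ('v \<times> nat \<times> nat) set" where
  "lead_edges T = {lead_edge T s t | s t. s \<in> relations T \<and> t < len (fst s)}"

lemma lead_edge_in: "s \<in> relations T \<Longrightarrow> t < len (fst s) \<Longrightarrow> lead_edge T s t \<in> lead_edges T"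
  unfolding lead_edges_def by blast

text \<open>Each edge lies on some leading path for \<open>a\<close>, at the same position. The node
  shared by two consecutive edges records the ranks of both ends, so the whole path uses one pair of
  ends, which \<open>f 0\<close> and \<open>f (len a)\<close> identify as
  \<open>(i, j)\<close>.\<close>

lemma lead_path_unique:
  assumes T: "finite T" and a: "a < length es" and ij: "i \<in> T" "j \<in> T"
    and f: "f 0 = i" "f (len a) = j"
    and sp: "\<And>t. t < len a \<Longrightarrow> special_at a t (edge a f t)"
    and le: "\<And>t. t < len a \<Longrightarrow> edge a f t \<in> lead_edges T"
    and t: "t \<le> len a"
  shows "f t = lead_nodes T (a, i, j) t"
proof -
  have "\<exists>i' j'. i' \<in> T \<and> j' \<in> T \<and> edge a f t = lead_edge T (a, i', j') t" if t: "t < len a" for t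
  proof -
    obtain s t' where s: "s \<in> relations T" "t' < len (fst s)" "edge a f t = lead_edge T s t'"
      using le[OF t] by (auto simp: lead_edges_def)
    have "fst s < length es" using s(1) by (auto simp: relations_def)
    then have "fst s = a" "t' = t"
      using special_at_unique[OF special_at_lead_edge[of s t' T]] sp[OF t] s by auto
    then show ?thesis using s by (cases s) (auto simp: relations_def)
  qed
  then obtain I J where IJ: "\<And>t. t < len a \<Longrightarrow> I t \<in> T \<and> J t \<in> T \<and> edge a f t = lead_edge T (a, I t, J t) t"
    by metis
  have const: "I t = I 0 \<and> J t = J 0" if "t < len a" for t
    using that
  proof (induction t)
    case (Suc t)
    have "f (Suc t) = lead_nodes T (a, I t, J t) (Suc t)"
      using IJ[of t] Suc.prems by (simp add: edge_def)
    moreover have "f (Suc t) = lead_nodes T (a, I (Suc t), J (Suc t)) (Suc t)"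
      using IJ[of "Suc t"] Suc.prems by (simp add: edge_def)
    ultimately have "rank T (I t) = rank T (I (Suc t))" "rank T (J t) = rank T (J (Suc t))"
      using Suc.prems by (simp_all add: lead_nodes_def)
    then have "I t = I (Suc t)" "J t = J (Suc t)"
      using IJ[of t] IJ[of "Suc t"] Suc.prems rank_eq_iff[OF T] by auto
    then show ?case using Suc by simp
  qed simp
  have I0: "I 0 = i" using IJ[of 0] len_pos[OF a] f by (simp add: edge_def lead_nodes_def)
  obtain l where l: "len a = Suc l" using len_pos[OF a] by (cases "len a") auto
  have "J l = j" using IJ[of l] f l by (simp add: edge_def lead_nodes_def)
  then have J0: "J 0 = j" using const[of l] l by simp
  show ?thesis
  proof (cases "t < len a")
    case True
    have "f t = lead_nodes T (a, I t, J t) t"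
      using IJ[OF True] by (simp add: edge_def)
    then show ?thesis using const[OF True] I0 J0 by simp
  next
    case False
    then show ?thesis using t f l by (simp add: lead_nodes_def)
  qed
qed

section \<open>External indices\<close>

text \<open>When a relation \<open>(a, i, j)\<close> is replaced by a path of special edges,
  \<open>i\<close> and \<open>j\<close> remain readable from the first and the last edge. Reading
  them off makes \<open>externals\<close> invariant under the leading differential.\<close>

definition outer :: "('v \<times> nat \<times> nat) set \<Rightarrow> nat set" where
  "outer X = {i. \<exists>a k j. (k, i, j) \<in> X \<and> special_at a 0 (k, i, j)} \<union>
     {j. \<exists>a k i. (k, i, j) \<in> X \<and> special_at a (len a - 1) (k, i, j)}"

definition externals :: "ridx set \<Rightarrow> (('v \<times> nat \<times> nat) \<Rightarrow>\<^sub>0 nat) \<Rightarrow> nat set" where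
  "externals S \<alpha> = (\<Union>(a, i, j)\<in>S. {i, j}) \<union> outer (Poly_Mapping.keys \<alpha>)"

lemma outer_Un: "outer (X \<union> Y) = outer X \<union> outer Y"
  unfolding outer_def by blast

lemma outer_row: "x \<in> X \<Longrightarrow> special_at a 0 x \<Longrightarrow> fst (snd x) \<in> outer X"
  by (cases x) (auto simp: outer_def)

lemma outer_col: "x \<in> X \<Longrightarrow> special_at a (len a - 1) x \<Longrightarrow> snd (snd x) \<in> outer X"
  unfolding outer_def by (cases x) force

lemma outer_subset: "outer X \<subseteq> (fst \<circ> snd) ` X \<union> (snd \<circ> snd) ` X"
  by (force simp: outer_def)

lemma finite_externals: "finite S \<Longrightarrow> finite (externals S \<alpha>)"
  unfolding externals_def
  by (intro finite_UnI finite_UN_I finite_subset[OF outer_subset]) auto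

text \<open>An edge has only one relation and position, so nothing but the first and the last edge
  of the path is read by \<open>outer\<close>.\<close>

lemma outer_path:
  assumes a: "a < length es" and sp: "\<And>t. t < len a \<Longrightarrow> special_at a t (edge a f t)"
  shows "outer (edge a f ` {..<len a}) = {f 0, f (len a)}"
proof (intro equalityI subsetI)
  obtain l where l: "len a = Suc l" using len_pos[OF a] by (cases "len a") auto
  fix n assume "n \<in> outer (edge a f ` {..<len a})"
  then consider (row) b k j t where "t < len a" "(k, n, j) = edge a f t" "special_at b 0 (k, n, j)"
    | (col) b k i t where "t < len a" "(k, i, n) = edge a f t" "special_at b (len b - 1) (k, i, n)"
    unfolding outer_def by auto
  then show "n \<in> {f 0, f (len a)}"
  proof cases
    case row
    then have "t = 0" using special_at_unique[OF sp[of t]] by force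
    then show ?thesis using row by (simp add: edge_def)
  next
    case col
    then have "a = b" "t = len b - 1"
      using special_at_unique[OF sp[OF col(1)], of b "len b - 1"] by simp_all
    then show ?thesis using col l by (simp add: edge_def)
  qed
next
  obtain l where l: "len a = Suc l" using len_pos[OF a] by (cases "len a") auto
  fix n assume "n \<in> {f 0, f (len a)}"
  then show "n \<in> outer (edge a f ` {..<len a})"
  proof (elim insertE emptyE)
    assume "n = f 0"
    then show ?thesis
      using outer_row[of "edge a f 0" "edge a f ` {..<len a}" a] sp[of 0] l by (simp add: edge_def)
  next
    assume "n = f (len a)"
    then show ?thesis
      using outer_col[of "edge a f l" "edge a f ` {..<len a}" a] sp[of l] l by (simp add: edge_def)
  qed
qed

text \<open>The indices lost with \<open>(a, i, j)\<close> come back through \<open>outer\<close> of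
  the path.\<close>

lemma externals_path:
  assumes "(a, i, j) \<in> S" "a < length es" "f 0 = i" "f (len a) = j"
    "\<And>t. t < len a \<Longrightarrow> special_at a t (edge a f t)"
  shows "externals (S - {(a, i, j)}) (path_exp a f + \<alpha>) = externals S \<alpha>"
proof -
  have "outer (Poly_Mapping.keys (path_exp a f + \<alpha>)) = {i, j} \<union> outer (Poly_Mapping.keys \<alpha>)"
    by (simp only: keys_add_nat outer_Un keys_path_exp outer_path[of a f, OF assms(2,5)] assms(3,4))
  moreover have "(\<Union>(a, i, j)\<in>S. {i, j}) = {i, j} \<union> (\<Union>(a, i, j)\<in>S - {(a, i, j)}. {i, j})"
  proof -
    have "(\<Union>(a, i, j)\<in>insert (a, i, j) (S - {(a, i, j)}). {i, j})
        = {i, j} \<union> (\<Union>(a, i, j)\<in>S - {(a, i, j)}. {i, j})" by (simp only: UN_insert prod.case)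
    then show ?thesis by (simp only: insert_Diff[OF assms(1)])
  qed
  ultimately show ?thesis unfolding externals_def by (simp only: Un_assoc Un_left_commute)
qed

end

section \<open>The truncated complex and its keys\<close>

locale truncated_koszul = nonoverlapping_words es for es :: "'v list list" +
  fixes m :: "'v \<Rightarrow> nat" and d r :: nat
  assumes m_pos: "0 < m k"
    and inner_node_less: "a < length es \<Longrightarrow> t < len a \<Longrightarrow> p < 2 * r \<Longrightarrow> q < 2 * r \<Longrightarrow>
      inner_node a t p q < d"
begin

definition weight :: "ridx set \<Rightarrow> (('v \<times> nat \<times> nat) \<Rightarrow>\<^sub>0 nat) \<Rightarrow> nat" where
  "weight S \<alpha> = (\<Sum>(a, i, j)\<in>S. \<Sum>t<len a. m (es ! a ! t)) + wt (m \<circ> fst) \<alpha>"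

definition admissible :: "ridx set \<Rightarrow> (('v \<times> nat \<times> nat) \<Rightarrow>\<^sub>0 nat) \<Rightarrow> bool" where
  "admissible S \<alpha> \<longleftrightarrow> S \<subseteq> {..<length es} \<times> {..<d} \<times> {..<d} \<and>
     Poly_Mapping.keys \<alpha> \<subseteq> UNIV \<times> {..<d} \<times> {..<d} \<and> weight S \<alpha> \<le> r"

lemma admissible_finite: "admissible S \<alpha> \<Longrightarrow> finite S"
  unfolding admissible_def by (meson finite_SigmaI finite_lessThan finite_subset)

lemma admissible_in:
  "admissible S \<alpha> \<Longrightarrow> (a, i, j) \<in> S \<Longrightarrow> a < length es \<and> i < d \<and> j < d"
  by (auto simp: admissible_def)

text \<open>A generator \<open>(a, i, j)\<close> counts as if all \<open>len a\<close> edges of its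
  path were in \<open>X\<close>. Hence replacing it by a path lowers the count by the number of
  edges outside \<open>X\<close>.\<close>

definition edge_count :: "('v \<times> nat \<times> nat) set \<Rightarrow> ridx set \<Rightarrow> (('v \<times> nat \<times> nat) \<Rightarrow>\<^sub>0 nat) \<Rightarrow> nat" where
  "edge_count X S \<alpha> = (\<Sum>(a, i, j)\<in>S. len a) + wt (\<lambda>x. of_bool (x \<in> X)) \<alpha>"

text \<open>A lexicographic order: the second count is at most \<open>r\<close>.\<close>

definition key :: "ridx set \<Rightarrow> (('v \<times> nat \<times> nat) \<Rightarrow>\<^sub>0 nat) \<Rightarrow> nat" where
  "key S \<alpha> = edge_count (Collect special) S \<alpha> * Suc r +
     edge_count (lead_edges (externals S \<alpha>)) S \<alpha>"

lemma weight_path: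
  assumes "finite S" "(a, i, j) \<in> S"
  shows "weight (S - {(a, i, j)}) (path_exp a f + \<alpha>) = weight S \<alpha>"
  using sum.remove[OF assms, of "\<lambda>(a, i, j). \<Sum>t<len a. m (es ! a ! t)"]
  by (simp add: weight_def wt_add wt_path_exp edge_def)

lemma admissible_path:
  assumes S: "admissible S \<alpha>" "(a, i, j) \<in> S" and f: "\<And>t. t \<le> len a \<Longrightarrow> f t < d"
  shows "admissible (S - {(a, i, j)}) (path_exp a f + \<alpha>)"
proof -
  have "Poly_Mapping.keys (path_exp a f) \<subseteq> UNIV \<times> {..<d} \<times> {..<d}"
    using f by (auto simp: keys_path_exp edge_def)
  then show ?thesis
    using S weight_path[OF admissible_finite[OF S(1)] S(2), of f \<alpha>]
    by (auto simp: admissible_def keys_add_nat)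
qed

lemma edge_count_path:
  assumes "finite S" "(a, i, j) \<in> S"
  shows "edge_count X (S - {(a, i, j)}) (path_exp a f + \<alpha>) + card {t. t < len a \<and> edge a f t \<notin> X}
    = edge_count X S \<alpha>"
proof -
  have "len a = (\<Sum>t<len a. 1)" by simp
  also have "\<dots> = (\<Sum>t<len a. of_bool (edge a f t \<in> X) + of_bool (edge a f t \<notin> X))"
    by (rule sum.cong) auto
  also have "\<dots> = wt (\<lambda>x. of_bool (x \<in> X)) (path_exp a f) + (\<Sum>t<len a. of_bool (edge a f t \<notin> X))"
    by (simp add: wt_path_exp sum.distrib)
  also have "(\<Sum>t<len a. of_bool (edge a f t \<notin> X)) = (\<Sum>t\<in>{t. t < len a \<and> edge a f t \<notin> X}. 1)"
    by (rule sum.mono_neutral_cong_right) auto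
  also have "\<dots> = card {t. t < len a \<and> edge a f t \<notin> X}" by simp
  finally show ?thesis
    using sum.remove[OF assms, of "\<lambda>(a, i, j). len a"]
    by (simp add: edge_count_def wt_add)
qed

lemma len_le_weight: "len a \<le> (\<Sum>t<len a. m (es ! a ! t))"
  using sum_mono[of "{..<len a}" "\<lambda>_. 1" "\<lambda>t. m (es ! a ! t)"] m_pos by (simp add: Suc_le_eq)

text \<open>Every counted edge has weight at least 1 because \<open>m\<close> is positive. The bound
  lets the factor \<open>Suc r\<close> in \<open>key\<close> give priority to the first
  count.\<close>

lemma edge_count_le:
  assumes "admissible S \<alpha>"
  shows "edge_count X S \<alpha> \<le> r"
proof -
  have "edge_count X S \<alpha> \<le> weight S \<alpha>"
    unfolding edge_count_def weight_def
  proof (intro add_mono sum_mono wt_le)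
    show "of_bool (x \<in> X) \<le> (m \<circ> fst) x" for x :: "'v \<times> nat \<times> nat"
      using m_pos[of "fst x"] by simp
  qed (use len_le_weight in auto)
  then show ?thesis using assms by (simp add: admissible_def)
qed

lemma externals_subset:
  assumes "admissible S \<alpha>"
  shows "externals S \<alpha> \<subseteq> {..<d}"
proof -
  have "(\<Union>(a, i, j)\<in>S. {i, j}) \<subseteq> {..<d}"
    using admissible_in[OF assms] by auto
  moreover have "(fst \<circ> snd) ` Poly_Mapping.keys \<alpha> \<union> (snd \<circ> snd) ` Poly_Mapping.keys \<alpha> \<subseteq> {..<d}"
    using assms by (auto simp: admissible_def)
  ultimately show ?thesis
    unfolding externals_def by (rule Un_least[OF _ order.trans[OF outer_subset]])
qed

lemma card_indices_le:
  assumes "finite X"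
  shows "card ((fst \<circ> snd) ` X \<union> (snd \<circ> snd) ` X) \<le> card X + card X"
  by (rule order.trans[OF card_Un_le add_mono[OF card_image_le[OF assms] card_image_le[OF assms]]])

text \<open>Each generator in \<open>S\<close> and each variable of \<open>\<alpha>\<close> shows at
  most two indices and has weight at least 1.\<close>

lemma card_externals:
  assumes "admissible S \<alpha>"
  shows "card (externals S \<alpha>) \<le> 2 * r"
proof -
  have fin: "finite S" by (rule admissible_finite[OF assms])
  let ?K = "Poly_Mapping.keys \<alpha>"
  have "card (externals S \<alpha>) \<le> card (\<Union>(a, i, j)\<in>S. {i, j}) + card (outer ?K)"
    unfolding externals_def by (rule card_Un_le)
  also have "\<dots> \<le> (card S + card S) + (card ?K + card ?K)"
    by (intro add_mono order.trans[OF card_mono card_indices_le] outer_subset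
        finite_UnI finite_imageI fin finite_keys) force
  also have "\<dots> = 2 * (card S + card ?K)" by simp
  also have "card S + card ?K \<le> weight S \<alpha>"
    unfolding weight_def
  proof (rule add_mono)
    have "card S = (\<Sum>s\<in>S. 1)" by simp
    also have "\<dots> \<le> (\<Sum>(a, i, j)\<in>S. \<Sum>t<len a. m (es ! a ! t))"
    proof (rule sum_mono)
      fix s assume "s \<in> S"
      then have "0 < len (fst s)" using admissible_in[OF assms] len_pos by (cases s) auto
      then show "1 \<le> (case s of (a, i, j) \<Rightarrow> \<Sum>t<len a. m (es ! a ! t))"
        using len_le_weight[of "fst s"] by (cases s) (simp only: prod.case fst_conv)
    qed
    finally show "card S \<le> (\<Sum>(a, i, j)\<in>S. \<Sum>t<len a. m (es ! a ! t))" .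
    show "card ?K \<le> wt (m \<circ> fst) \<alpha>" by (rule card_keys_le_wt) (simp add: m_pos)
  qed
  also have "weight S \<alpha> \<le> r" using assms by (simp add: admissible_def)
  finally show ?thesis by simp
qed

text \<open>Ranks stay below the number of external indices and so below \<open>2 * r\<close>, the
  range in which \<open>inner_node_less\<close> keeps inner nodes inside the matrix.\<close>

lemma lead_nodes_less:
  assumes S: "admissible S \<alpha>" and s: "s \<in> relations (externals S \<alpha>)" and t: "t \<le> len (fst s)"
  shows "lead_nodes (externals S \<alpha>) s t < d"
proof -
  have fin: "finite (externals S \<alpha>)" using S by (intro finite_externals admissible_finite)
  have less: "rank (externals S \<alpha>) i < 2 * r" if "i \<in> externals S \<alpha>" for i
    using rank_less_card[OF fin that] card_externals[OF S] by simp
  show ?thesis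
    using s t less externals_subset[OF S]
    by (auto simp: lead_nodes_def relations_def intro!: inner_node_less split: prod.splits)
qed

lemma in_relations:
  assumes "admissible S \<alpha>" "s \<in> S"
  shows "s \<in> relations (externals S \<alpha>)"
  using assms admissible_in[OF assms(1)] by (cases s) (force simp: relations_def externals_def)

text \<open>If some edge is not special, the first count drops, and the second is too small to make
  up for it. Otherwise \<open>special_walk\<close> applies, the external indices do not change, and
  the second count drops unless all edges are in \<open>lead_edges\<close>; then
  \<open>lead_path_unique\<close> leaves only the leading path.\<close>

lemma key_path:
  assumes S: "admissible S \<alpha>" and s: "(a, i, j) \<in> S" and f: "f 0 = i" "f (len a) = j" "\<And>t. t \<le> len a \<Longrightarrow> f t < d"
  shows "key (S - {(a, i, j)}) (path_exp a f + \<alpha>) < key S \<alpha> \<or>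
    (\<forall>t\<le>len a. f t = lead_nodes (externals S \<alpha>) (a, i, j) t)"
proof -
  have fin: "finite S" by (rule admissible_finite[OF S])
  have a: "a < length es" using admissible_in[OF S s] by simp
  define S' \<alpha>' where "S' = S - {(a, i, j)}" and "\<alpha>' = path_exp a f + \<alpha>"
  have adm: "admissible S' \<alpha>'" unfolding S'_def \<alpha>'_def by (rule admissible_path[OF S s f(3)])
  note count = edge_count_path[OF fin s, of _ f \<alpha>, folded S'_def \<alpha>'_def]
  show ?thesis
  proof (cases "\<forall>t<len a. special (edge a f t)")
    case False
    then obtain t where t: "t < len a" "\<not> special (edge a f t)" by blast
    then have "0 < card {t. t < len a \<and> edge a f t \<notin> Collect special}"
      by (auto simp: card_gt_0_iff)
    then have "edge_count (Collect special) S' \<alpha>' < edge_count (Collect special) S \<alpha>"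
      using count[of "Collect special"] by linarith
    then have "Suc (edge_count (Collect special) S' \<alpha>') * Suc r \<le> edge_count (Collect special) S \<alpha> * Suc r"
      by (intro mult_right_mono) auto
    moreover have "edge_count (lead_edges (externals S' \<alpha>')) S' \<alpha>' \<le> r" by (rule edge_count_le[OF adm])
    ultimately have "key S' \<alpha>' < key S \<alpha>" by (simp add: key_def)
    then show ?thesis by (simp add: S'_def \<alpha>'_def)
  next
    case True
    have sp: "special_at a t (edge a f t)" if "t < len a" for t
      using special_walk[OF a _ that] True by blast
    \<comment> \<open>Without this the second counts before and after would refer to different edge
      sets.\<close>
    have T: "externals S' \<alpha>' = externals S \<alpha>"
      unfolding S'_def \<alpha>'_def by (rule externals_path[OF s a f(1,2) sp])
    have "{t. t < len a \<and> edge a f t \<notin> Collect special} = {}" using True by auto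
    then have spec: "edge_count (Collect special) S' \<alpha>' = edge_count (Collect special) S \<alpha>"
      using count[of "Collect special"] by (simp only: card.empty)
    show ?thesis
    proof (cases "\<forall>t<len a. edge a f t \<in> lead_edges (externals S \<alpha>)")
      case False
      then have "0 < card {t. t < len a \<and> edge a f t \<notin> lead_edges (externals S \<alpha>)}"
        by (auto simp: card_gt_0_iff)
      then have "edge_count (lead_edges (externals S \<alpha>)) S' \<alpha>' < edge_count (lead_edges (externals S \<alpha>)) S \<alpha>"
        using count[of "lead_edges (externals S \<alpha>)"] by linarith
      then have "key S' \<alpha>' < key S \<alpha>" by (simp add: key_def T spec)
      then show ?thesis by (simp add: S'_def \<alpha>'_def)
    next
      case True
      have "i \<in> externals S \<alpha>" "j \<in> externals S \<alpha>"
        using in_relations[OF S s] by (auto simp: relations_def)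
      then show ?thesis
        using lead_path_unique[OF finite_externals[OF fin] a _ _ f(1,2) sp] True by blast
    qed
  qed
qed

text \<open>No edge of the leading path is missing from either edge set, so neither count
  drops.\<close>

lemma lead_step:
  assumes S: "admissible S \<alpha>" and s: "s \<in> S"
  defines "T \<equiv> externals S \<alpha>"
  shows "admissible (S - {s}) (lead_exp T s + \<alpha>)"
    and "externals (S - {s}) (lead_exp T s + \<alpha>) = T"
    and "key (S - {s}) (lead_exp T s + \<alpha>) = key S \<alpha>"
proof -
  obtain a i j where aij: "s = (a, i, j)" by (cases s)
  have fin: "finite S" by (rule admissible_finite[OF S])
  have a: "a < length es" using admissible_in[OF S] s aij by simp
  note aS = s[unfolded aij]
  note rel = in_relations[OF S s, folded T_def]
  have len: "0 < len a" by (rule len_pos[OF a])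
  have f: "lead_nodes T s 0 = i" "lead_nodes T s (len a) = j"
    using len by (simp_all add: aij lead_nodes_def)
  have sp: "special_at a t (edge a (lead_nodes T s) t)" if "t < len a" for t
    using special_at_lead_edge[of s t T] a that by (simp add: aij)
  have exp: "lead_exp T s = path_exp a (lead_nodes T s)" by (simp add: lead_exp_def aij)
  show "admissible (S - {s}) (lead_exp T s + \<alpha>)"
    using admissible_path[OF S aS, of "lead_nodes T s"] lead_nodes_less[OF S in_relations[OF S s]]
    unfolding exp unfolding T_def aij by simp
  show ext: "externals (S - {s}) (lead_exp T s + \<alpha>) = T"
    using externals_path[OF aS a f sp] unfolding exp unfolding T_def aij by simp
  have c: "edge_count X (S - {s}) (lead_exp T s + \<alpha>) = edge_count X S \<alpha>"
    if "\<And>t. t < len a \<Longrightarrow> edge a (lead_nodes T s) t \<in> X" for X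
  proof -
    have "{t. t < len a \<and> edge a (lead_nodes T s) t \<notin> X} = {}" using that by blast
    then show ?thesis
      using edge_count_path[OF fin aS, of X "lead_nodes T s" \<alpha>] unfolding exp unfolding aij
      by (simp only: card.empty add_0_right)
  qed
  have c1: "edge_count (Collect special) (S - {s}) (lead_exp T s + \<alpha>) = edge_count (Collect special) S \<alpha>"
    by (rule c) (use sp in \<open>auto simp: special_def\<close>)
  have c2: "edge_count (lead_edges T) (S - {s}) (lead_exp T s + \<alpha>) = edge_count (lead_edges T) S \<alpha>"
    by (rule c) (use lead_edge_in[OF rel] aij in simp)
  show "key (S - {s}) (lead_exp T s + \<alpha>) = key S \<alpha>"
    by (simp only: key_def ext c1 c2 flip: T_def)
qed

end

section \<open>Linear operators on the exterior algebra\<close>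

definition ext_coeff :: "'v ext \<Rightarrow> ridx set \<Rightarrow> (('v \<times> nat \<times> nat) \<Rightarrow>\<^sub>0 nat) \<Rightarrow> complex" where
  "ext_coeff \<xi> S \<alpha> = Poly_Mapping.lookup (Poly_Mapping.lookup \<xi> S) \<alpha>"

definition ext_basis :: "ridx set \<Rightarrow> (('v \<times> nat \<times> nat) \<Rightarrow>\<^sub>0 nat) \<Rightarrow> 'v ext" where
  "ext_basis S \<alpha> = Poly_Mapping.single S (Poly_Mapping.single \<alpha> 1)"

definition cscale :: "complex \<Rightarrow> 'v ext \<Rightarrow> 'v ext" where
  "cscale c = ext_scale (cconst c)"

definition ext_supp :: "'v ext \<Rightarrow> (ridx set \<times> (('v \<times> nat \<times> nat) \<Rightarrow>\<^sub>0 nat)) set" where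
  "ext_supp \<xi> = {(S, \<alpha>). ext_coeff \<xi> S \<alpha> \<noteq> 0}"

lemma ext_eqI: "(\<And>S \<alpha>. ext_coeff \<xi> S \<alpha> = ext_coeff \<eta> S \<alpha>) \<Longrightarrow> \<xi> = \<eta>"
  by (intro poly_mapping_eqI) (simp add: ext_coeff_def)

lemma ext_coeff_add [simp]: "ext_coeff (\<xi> + \<eta>) S \<alpha> = ext_coeff \<xi> S \<alpha> + ext_coeff \<eta> S \<alpha>"
  by (simp add: ext_coeff_def lookup_add)

lemma ext_coeff_diff [simp]: "ext_coeff (\<xi> - \<eta>) S \<alpha> = ext_coeff \<xi> S \<alpha> - ext_coeff \<eta> S \<alpha>"
  by (simp add: ext_coeff_def lookup_minus)

lemma ext_coeff_0 [simp]: "ext_coeff 0 S \<alpha> = 0"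
  by (simp add: ext_coeff_def)

lemma ext_coeff_sum: "ext_coeff (sum f A) S \<alpha> = (\<Sum>x\<in>A. ext_coeff (f x) S \<alpha>)"
  by (simp add: ext_coeff_def lookup_sum)

lemma ext_coeff_basis: "ext_coeff (ext_basis S \<alpha>) S' \<alpha>' = of_bool (S = S' \<and> \<alpha> = \<alpha>')"
  by (simp add: ext_coeff_def ext_basis_def lookup_single when_def)

lemma ext_coeff_cscale [simp]: "ext_coeff (cscale c \<xi>) S \<alpha> = c * ext_coeff \<xi> S \<alpha>"
proof -
  have "cconst c * p = Poly_Mapping.map ((*) c) p" for p :: "'a cpoly"
    by (simp add: cconst_def mult_map_scale_conv_mult)
  then show ?thesis
    by (simp add: ext_coeff_def cscale_def lookup_ext_scale Poly_Mapping.map.rep_eq when_def)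
qed

lemma finite_ext_supp [simp]: "finite (ext_supp \<xi>)"
proof (rule finite_subset)
  show "ext_supp \<xi> \<subseteq> (SIGMA S:Poly_Mapping.keys \<xi>. Poly_Mapping.keys (Poly_Mapping.lookup \<xi> S))"
    by (auto simp: ext_supp_def ext_coeff_def in_keys_iff)
qed simp

lemma cscale_add: "cscale c (\<xi> + \<eta>) = cscale c \<xi> + cscale c \<eta>"
  by (rule ext_eqI) (simp add: distrib_left)

lemma cscale_cscale: "cscale c (cscale c' \<xi>) = cscale (c * c') \<xi>"
  by (rule ext_eqI) simp

lemma cscale_sum: "cscale c (sum f A) = (\<Sum>x\<in>A. cscale c (f x))"
  by (simp add: cscale_def ext_scale_sum)

lemma cscale_1 [simp]: "cscale 1 \<xi> = \<xi>"
  by (rule ext_eqI) simp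

lemma cscale_0_right [simp]: "cscale c 0 = 0"
  by (rule ext_eqI) simp

lemma ext_expansion: "\<xi> = (\<Sum>(S, \<alpha>)\<in>ext_supp \<xi>. cscale (ext_coeff \<xi> S \<alpha>) (ext_basis S \<alpha>))"
proof (rule ext_eqI)
  fix S \<alpha>
  have "ext_coeff (\<Sum>(S, \<alpha>)\<in>ext_supp \<xi>. cscale (ext_coeff \<xi> S \<alpha>) (ext_basis S \<alpha>)) S \<alpha>
      = (\<Sum>b\<in>ext_supp \<xi>. if b = (S, \<alpha>) then ext_coeff \<xi> S \<alpha> else 0)"
    unfolding ext_coeff_sum by (rule sum.cong) (auto simp: ext_coeff_basis)
  also have "\<dots> = ext_coeff \<xi> S \<alpha>"
    unfolding sum.delta[OF finite_ext_supp] by (simp add: ext_supp_def)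
  finally show "ext_coeff \<xi> S \<alpha>
      = ext_coeff (\<Sum>(S, \<alpha>)\<in>ext_supp \<xi>. cscale (ext_coeff \<xi> S \<alpha>) (ext_basis S \<alpha>)) S \<alpha>" ..
qed

text \<open>Linear over the complex numbers only: the contraction is prescribed monomial by
  monomial, with choices depending on the exponent, and need not respect polynomial
  coefficients.\<close>

definition ext_linear :: "('v ext \<Rightarrow> 'v ext) \<Rightarrow> bool" where
  "ext_linear L \<longleftrightarrow> (\<forall>\<xi> \<eta>. L (\<xi> + \<eta>) = L \<xi> + L \<eta>) \<and> (\<forall>c \<xi>. L (cscale c \<xi>) = cscale c (L \<xi>))"

lemma ext_linear_add: "ext_linear L \<Longrightarrow> L (\<xi> + \<eta>) = L \<xi> + L \<eta>"
  and ext_linear_cscale: "ext_linear L \<Longrightarrow> L (cscale c \<xi>) = cscale c (L \<xi>)"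
  by (simp_all add: ext_linear_def)

lemma ext_linear_0: "ext_linear L \<Longrightarrow> L 0 = 0"
  using ext_linear_add[of L 0 0] by simp

lemma ext_linear_sum: "ext_linear L \<Longrightarrow> L (sum f A) = (\<Sum>x\<in>A. L (f x))"
  by (induction A rule: infinite_finite_induct) (simp_all add: ext_linear_0 ext_linear_add)

lemma ext_linear_diff: "ext_linear L \<Longrightarrow> L (\<xi> - \<eta>) = L \<xi> - L \<eta>"
  using ext_linear_add[of L "\<xi> - \<eta>" \<eta>] by (simp add: eq_diff_eq)

lemma ext_linear_compose: "ext_linear L \<Longrightarrow> ext_linear L' \<Longrightarrow> ext_linear (\<lambda>\<xi>. L (L' \<xi>))"
  by (simp add: ext_linear_def)

lemma ext_linear_minus: "ext_linear L \<Longrightarrow> ext_linear L' \<Longrightarrow> ext_linear (\<lambda>\<xi>. L \<xi> - L' \<xi>)"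
  by (auto simp: ext_linear_def right_diff_distrib intro: ext_eqI)

lemma ext_linear_id: "ext_linear (\<lambda>\<xi>. \<xi>)"
  by (simp add: ext_linear_def)

lemma ext_linear_koszul_d: "ext_linear (koszul_d es d)"
  by (simp add: ext_linear_def koszul_d_add cscale_def koszul_d_scale)

definition ext_extend ::
    "(ridx set \<Rightarrow> (('v \<times> nat \<times> nat) \<Rightarrow>\<^sub>0 nat) \<Rightarrow> 'v ext) \<Rightarrow> 'v ext \<Rightarrow> 'v ext" where
  "ext_extend f \<xi> = (\<Sum>(S, \<alpha>)\<in>ext_supp \<xi>. cscale (ext_coeff \<xi> S \<alpha>) (f S \<alpha>))"

lemma ext_extend_eq_sum:
  assumes "finite A" "ext_supp \<xi> \<subseteq> A"
  shows "ext_extend f \<xi> = (\<Sum>(S, \<alpha>)\<in>A. cscale (ext_coeff \<xi> S \<alpha>) (f S \<alpha>))"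
  unfolding ext_extend_def
  by (rule sum.mono_neutral_left) (use assms in \<open>auto simp: ext_supp_def intro: ext_eqI\<close>)

lemma ext_linear_extend: "ext_linear (ext_extend f)"
  unfolding ext_linear_def
proof (intro conjI allI)
  fix \<xi> \<eta> :: "'a ext" and c
  let ?A = "ext_supp \<xi> \<union> ext_supp \<eta>"
  have "ext_supp (\<xi> + \<eta>) \<subseteq> ?A" by (auto simp: ext_supp_def)
  moreover have "cscale (a + b) \<zeta> = cscale a \<zeta> + cscale b \<zeta>" for a b and \<zeta> :: "'a ext"
    by (rule ext_eqI) (simp add: distrib_right)
  ultimately show "ext_extend f (\<xi> + \<eta>) = ext_extend f \<xi> + ext_extend f \<eta>"
    by (simp add: ext_extend_eq_sum[of ?A] case_prod_unfold sum.distrib)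
  have "ext_supp (cscale c \<xi>) \<subseteq> ext_supp \<xi>" by (auto simp: ext_supp_def)
  then show "ext_extend f (cscale c \<xi>) = cscale c (ext_extend f \<xi>)"
    by (simp add: ext_extend_eq_sum[of "ext_supp \<xi>"] case_prod_unfold cscale_sum cscale_cscale)
qed

lemma ext_extend_basis: "ext_extend f (ext_basis S \<alpha>) = f S \<alpha>"
  by (subst ext_extend_eq_sum[of "{(S, \<alpha>)}"]) (auto simp: ext_supp_def ext_coeff_basis)

definition ext_span :: "(ridx set \<Rightarrow> (('v \<times> nat \<times> nat) \<Rightarrow>\<^sub>0 nat) \<Rightarrow> bool) \<Rightarrow> 'v ext set" where
  "ext_span P = {\<xi>. \<forall>S \<alpha>. \<not> P S \<alpha> \<longrightarrow> ext_coeff \<xi> S \<alpha> = 0}"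

lemma ext_span_0 [simp]: "0 \<in> ext_span P"
  by (simp add: ext_span_def)

lemma ext_span_add: "\<xi> \<in> ext_span P \<Longrightarrow> \<eta> \<in> ext_span P \<Longrightarrow> \<xi> + \<eta> \<in> ext_span P"
  by (simp add: ext_span_def)

lemma ext_span_cscale: "\<xi> \<in> ext_span P \<Longrightarrow> cscale c \<xi> \<in> ext_span P"
  by (simp add: ext_span_def)

lemma ext_span_diff: "\<xi> \<in> ext_span P \<Longrightarrow> \<eta> \<in> ext_span P \<Longrightarrow> \<xi> - \<eta> \<in> ext_span P"
  by (simp add: ext_span_def)

lemma ext_span_sum: "(\<And>x. x \<in> A \<Longrightarrow> f x \<in> ext_span P) \<Longrightarrow> sum f A \<in> ext_span P"
  by (induction A rule: infinite_finite_induct) (auto intro: ext_span_add)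

lemma ext_span_basis: "P S \<alpha> \<Longrightarrow> ext_basis S \<alpha> \<in> ext_span P"
  by (auto simp: ext_span_def ext_coeff_basis)

lemma ext_span_mono: "\<xi> \<in> ext_span P \<Longrightarrow> (\<And>S \<alpha>. P S \<alpha> \<Longrightarrow> Q S \<alpha>) \<Longrightarrow> \<xi> \<in> ext_span Q"
  by (auto simp: ext_span_def)

lemma ext_linear_span:
  assumes L: "ext_linear L" and b: "\<And>S \<alpha>. P S \<alpha> \<Longrightarrow> L (ext_basis S \<alpha>) \<in> ext_span Q"
    and \<xi>: "\<xi> \<in> ext_span P"
  shows "L \<xi> \<in> ext_span Q"
proof -
  have "L \<xi> = (\<Sum>(S, \<alpha>)\<in>ext_supp \<xi>. cscale (ext_coeff \<xi> S \<alpha>) (L (ext_basis S \<alpha>)))"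
    by (subst ext_expansion)
      (simp add: ext_linear_sum[OF L] ext_linear_cscale[OF L] case_prod_unfold)
  also have "\<dots> \<in> ext_span Q"
  proof (intro ext_span_sum)
    fix b assume "b \<in> ext_supp \<xi>"
    then have "P (fst b) (snd b)"
      using \<xi> by (cases b, simp add: ext_span_def ext_supp_def, blast)
    then show "(case b of (S, \<alpha>) \<Rightarrow> cscale (ext_coeff \<xi> S \<alpha>) (L (ext_basis S \<alpha>))) \<in> ext_span Q"
      by (auto simp: case_prod_unfold intro: ext_span_cscale assms(2))
  qed
  finally show ?thesis .
qed

section \<open>The Koszul differential squares to zero\<close>

lemma wedge_coeff: "wedge (Poly_Mapping.single {} c) \<xi> = ext_scale c \<xi>"
proof -
  have "wedge (Poly_Mapping.single {} c) \<xi> = (\<Sum>T\<in>Poly_Mapping.keys \<xi>.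
      wedge (Poly_Mapping.single {} c) (Poly_Mapping.single T (Poly_Mapping.lookup \<xi> T)))"
    by (subst ext_sum_single[of \<xi>, symmetric]) (simp only: wedge_sum_right)
  also have "\<dots> = (\<Sum>T\<in>Poly_Mapping.keys \<xi>.
      ext_scale c (Poly_Mapping.single T (Poly_Mapping.lookup \<xi> T)))"
    by (simp add: wedge_single wedge_basis_def ext_sign_def ext_scale_single)
  also have "\<dots> = ext_scale c \<xi>"
    by (simp only: ext_scale_sum[symmetric] ext_sum_single)
  finally show ?thesis .
qed

lemma ext_deg_0 [simp]: "0 \<in> ext_deg q"
  by (simp add: ext_deg_def)

lemma ext_deg_add: "\<xi> \<in> ext_deg q \<Longrightarrow> \<eta> \<in> ext_deg q \<Longrightarrow> \<xi> + \<eta> \<in> ext_deg q"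
  using keys_add[of \<xi> \<eta>] by (auto simp: ext_deg_def)

lemma ext_deg_sum: "(\<And>x. x \<in> A \<Longrightarrow> f x \<in> ext_deg q) \<Longrightarrow> sum f A \<in> ext_deg q"
  by (induction A rule: infinite_finite_induct) (auto intro: ext_deg_add)

lemma ext_deg_single: "finite S \<Longrightarrow> card S = q \<Longrightarrow> Poly_Mapping.single S c \<in> ext_deg q"
  by (simp add: ext_deg_def)

text \<open>Split off one generator \<open>x\<close> with differential \<open>p\<close>: the
  derivation rule gives p y - x dy for the differential of x y, and applying it again leaves p dy -
  p dy, as the second differential of \<open>y\<close> is 0 by induction.\<close>

lemma koszul_d_square_single:
  assumes "finite S"
  shows "koszul_d es d (koszul_d es d (Poly_Mapping.single S c)) = 0"
  using assms
proof (induction S arbitrary: c)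
  case empty
  then show ?case by (simp add: koszul_d_coeff)
next
  case (insert s S)
  \<comment> \<open>The sign in \<open>y\<close> undoes the one that \<open>wedge\<close>
    produces.\<close>
  define x y where "x = (Poly_Mapping.single {s} 1 :: 'a ext)"
    and "y = Poly_Mapping.single S (ext_sign {s} S * c)"
  have xy: "Poly_Mapping.single (insert s S) c = wedge x y"
    using insert.hyps
    by (simp add: x_def y_def wedge_single wedge_basis_def ext_sign_sq flip: mult.assoc)
  define p where "p = pullback es d s"
  have dx: "koszul_d es d x = Poly_Mapping.single {} p"
    by (simp add: x_def p_def koszul_d_generator)
  \<comment> \<open>For empty \<open>S\<close> the truncated \<open>card S - 1\<close> does no harm:
    the differential of \<open>y\<close> is 0, which has every degree.\<close>
  have deg: "x \<in> ext_deg 1" "y \<in> ext_deg (card S)" "koszul_d es d y \<in> ext_deg (card S - 1)"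
    using insert.hyps
    by (auto simp: x_def y_def koszul_d_single koszul_d_basis_def intro!: ext_deg_single ext_deg_sum)
  have d1: "koszul_d es d (wedge x y) = ext_scale p y + ext_scale (-1) (wedge x (koszul_d es d y))"
    using koszul_d_wedge[OF deg(1,2), of es d]
    by (simp add: dx wedge_coeff)
  have d2: "koszul_d es d (wedge x (koszul_d es d y)) = ext_scale p (koszul_d es d y)"
    using koszul_d_wedge[OF deg(1,3), of es d] insert.IH[of "ext_sign {s} S * c", folded y_def]
    by (simp add: dx wedge_coeff)
  have "\<zeta> + ext_scale (-1) \<zeta> = 0" for \<zeta> :: "'a ext"
    by (rule poly_mapping_eqI) (simp add: lookup_add lookup_ext_scale)
  then show ?case
    by (simp add: xy d1 d2 koszul_d_add koszul_d_scale)
qed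

lemma koszul_d_square:
  assumes "\<xi> \<in> ext_deg q"
  shows "koszul_d es d (koszul_d es d \<xi>) = 0"
proof -
  have "koszul_d es d (koszul_d es d \<xi>) = (\<Sum>S\<in>Poly_Mapping.keys \<xi>.
      koszul_d es d (koszul_d es d (Poly_Mapping.single S (Poly_Mapping.lookup \<xi> S))))"
    by (subst ext_sum_single[of \<xi>, symmetric]) (simp only: koszul_d_sum)
  also have "\<dots> = 0"
    using assms by (intro sum.neutral) (auto simp: ext_deg_def koszul_d_square_single)
  finally show ?thesis .
qed

section \<open>Matrix entries as sums over paths\<close>

definition paths :: "nat \<Rightarrow> nat \<Rightarrow> nat \<Rightarrow> nat \<Rightarrow> nat list set" where
  "paths d l i j = {ns. length ns = Suc l \<and> set ns \<subseteq> {..<d} \<and> hd ns = i \<and> last ns = j}"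

lemma finite_paths: "finite (paths d l i j)"
  by (rule finite_subset[OF _ finite_lists_length_eq[of "{..<d}" "Suc l"]]) (auto simp: paths_def)

lemma paths_0: "i < d \<Longrightarrow> paths d 0 i j = (if i = j then {[i]} else {})"
  by (auto simp: paths_def length_Suc_conv)

lemma paths_Suc: "i < d \<Longrightarrow> paths d (Suc l) i j = (\<Union>n<d. (#) i ` paths d l n j)"
  by (auto simp: paths_def length_Suc_conv image_iff)

lemma word_mat_carrier: "word_mat d w \<in> carrier_mat d d"
proof -
  have "foldr (\<lambda>k M. generic_mat d k * M) ks (1\<^sub>m d) \<in> carrier_mat d d" for ks
    by (induction ks) (auto simp: generic_mat_def)
  then show ?thesis by (simp add: word_mat_def)
qed

text \<open>Expansion of the matrix product along its first factor: prepending the row index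
  \<open>i\<close> to the paths of the remaining word gives the paths of the whole word.\<close>

lemma word_mat_entry:
  assumes "i < d" "j < d"
  shows "word_mat d (Word w) $$ (i, j) = (\<Sum>ns\<in>paths d (length w) i j.
    Poly_Mapping.single (\<Sum>t<length w. Poly_Mapping.single (w ! t, ns ! t, ns ! Suc t) 1) 1)"
  using assms(1)
proof (induction w arbitrary: i)
  case Nil
  then show ?case using assms by (simp add: word_mat_def paths_0)
next
  case (Cons k w)
  let ?E = "\<lambda>w ns. \<Sum>t<length w. Poly_Mapping.single (w ! t, ns ! t, ns ! Suc t) (1::nat)"
  have "word_mat d (Word (k # w)) $$ (i, j) =
      (\<Sum>n<d. cvar (k, i, n) * word_mat d (Word w) $$ (n, j))"
    using Cons.prems assms word_mat_carrier[of d "Word w"]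
    by (simp add: word_mat_def generic_mat_def scalar_prod_def atLeast0LessThan)
  also have "\<dots> = (\<Sum>n<d. \<Sum>ns\<in>paths d (length w) n j.
      Poly_Mapping.single (?E (k # w) (i # ns)) 1)"
  proof (rule sum.cong[OF refl])
    fix n assume n: "n \<in> {..<d}"
    have "?E (k # w) (i # ns) = Poly_Mapping.single (k, i, n) 1 + ?E w ns"
      if "ns \<in> paths d (length w) n j" for ns
    proof -
      have "ns ! 0 = n" using that by (cases ns) (auto simp: paths_def)
      then show ?thesis by (simp add: sum.lessThan_Suc_shift del: sum.lessThan_Suc)
    qed
    then show "cvar (k, i, n) * word_mat d (Word w) $$ (n, j) =
        (\<Sum>ns\<in>paths d (length w) n j. Poly_Mapping.single (?E (k # w) (i # ns)) 1)"
      using Cons.IH[of n] n by (simp add: cvar_def sum_distrib_left mult_single cong: sum.cong)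
  qed
  also have "\<dots> = (\<Sum>n<d. \<Sum>ns\<in>(#) i ` paths d (length w) n j. Poly_Mapping.single (?E (k # w) ns) 1)"
    by (rule sum.cong[OF refl]) (simp add: sum.reindex del: sum.lessThan_Suc)
  also have "\<dots> = (\<Sum>ns\<in>paths d (length (k # w)) i j. Poly_Mapping.single (?E (k # w) ns) 1)"
    unfolding list.size(4) One_nat_def add_Suc_right add_0_right paths_Suc[OF Cons.prems]
    by (rule sum.UNION_disjoint[symmetric]) (simp_all add: finite_paths, auto simp: paths_def)
  finally show ?case .
qed

lemma nc_eval_entry_monomial:
  "nc_eval_entry d (nc_monomial w) i j = word_mat d (Word w) $$ (i, j)"
  by (simp add: nc_eval_entry_def nc_monomial_def cconst_def)

section \<open>The leading part of the differential\<close>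

context truncated_koszul
begin

abbreviation D :: "'v ext \<Rightarrow> 'v ext" where
  "D \<equiv> koszul_d (map nc_monomial es) d"

text \<open>Filtration of the truncated complex by the key, in homological degree \<open>q\<close>.
  The bound is strict, so \<open>level q 0\<close> contains only 0.\<close>

definition level :: "nat \<Rightarrow> nat \<Rightarrow> 'v ext set" where
  "level q k = ext_span (\<lambda>S \<alpha>. admissible S \<alpha> \<and> card S = q \<and> key S \<alpha> < k)"

lemma level_basis: "admissible S \<alpha> \<Longrightarrow> card S = q \<Longrightarrow> key S \<alpha> < k \<Longrightarrow> ext_basis S \<alpha> \<in> level q k"
  unfolding level_def by (rule ext_span_basis) simp

lemma level_mono: "\<xi> \<in> level q k \<Longrightarrow> k \<le> l \<Longrightarrow> \<xi> \<in> level q l"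
  unfolding level_def by (erule ext_span_mono) simp

lemma level_linear:
  assumes "ext_linear L"
    and "\<And>S \<alpha>. admissible S \<alpha> \<Longrightarrow> card S = q \<Longrightarrow> key S \<alpha> < k \<Longrightarrow> L (ext_basis S \<alpha>) \<in> level q' k'"
    and "\<xi> \<in> level q k"
  shows "L \<xi> \<in> level q' k'"
  unfolding level_def
  by (rule ext_linear_span[OF assms(1) _ assms(3)[unfolded level_def]])
    (use assms(2)[unfolded level_def] in blast)

lemma pullback_relation:
  assumes "a < length es" "i < d" "j < d"
  shows "pullback (map nc_monomial es) d (a, i, j) =
    (\<Sum>ns\<in>paths d (len a) i j. Poly_Mapping.single (path_exp a ((!) ns)) 1)"
  using assms by (simp add: pullback_def nc_eval_entry_monomial word_mat_entry path_exp_def edge_def)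

definition path_terms :: "ridx set \<Rightarrow> (('v \<times> nat \<times> nat) \<Rightarrow>\<^sub>0 nat) \<Rightarrow> ridx \<Rightarrow> nat list set \<Rightarrow> 'v ext" where
  "path_terms S \<alpha> = (\<lambda>(a, i, j) P. \<Sum>ns\<in>P.
     cscale (ext_sign {(a, i, j)} (S - {(a, i, j)})) (ext_basis (S - {(a, i, j)}) (path_exp a ((!) ns) + \<alpha>)))"

lemma koszul_d_ext_basis:
  assumes "admissible S \<alpha>"
  shows "D (ext_basis S \<alpha>) = (\<Sum>(a, i, j)\<in>S. path_terms S \<alpha> (a, i, j) (paths d (len a) i j))"
proof -
  have "Poly_Mapping.single (S - {s}) (ext_sign {s} (S - {s}) * pullback (map nc_monomial es) d s *
      Poly_Mapping.single \<alpha> 1) = (case s of (a, i, j) \<Rightarrow> path_terms S \<alpha> s (paths d (len a) i j))"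
    if s: "s \<in> S" for s
  proof -
    obtain a i j where aij: "s = (a, i, j)" by (cases s)
    \<comment> \<open>\<open>koszul_d\<close> carries its signs as polynomials,
      \<open>cscale\<close> needs them as complex numbers.\<close>
    have sgn: "(ext_sign A B :: 'v cpoly) = cconst (ext_sign A B)" for A B
    proof -
      have "cconst ((-1) ^ n) = ((-1) ^ n :: 'v cpoly)" for n
      proof -
        have "cconst (a * b) = cconst a * (cconst b :: 'v cpoly)" for a b
          by (simp add: cconst_def mult_single)
        moreover have "cconst (- 1) = (- 1 :: 'v cpoly)" "cconst 1 = (1 :: 'v cpoly)"
          by (simp_all add: cconst_def single_uminus)
        ultimately show ?thesis by (induction n) (simp_all del: mult_minus1 mult_minus_left)
      qed
      then show ?thesis by (simp add: ext_sign_def)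
    qed
    have "Poly_Mapping.single (S - {s}) (ext_sign {s} (S - {s}) * pullback (map nc_monomial es) d s *
        Poly_Mapping.single \<alpha> 1) = ext_scale (ext_sign {s} (S - {s}))
          (Poly_Mapping.single (S - {s}) (pullback (map nc_monomial es) d s * Poly_Mapping.single \<alpha> 1))"
      by (simp add: ext_scale_single mult.assoc)
    also have "Poly_Mapping.single (S - {s}) (pullback (map nc_monomial es) d s * Poly_Mapping.single \<alpha> 1)
        = (\<Sum>ns\<in>paths d (len a) i j. ext_basis (S - {s}) (path_exp a ((!) ns) + \<alpha>))"
    proof (rule poly_mapping_eqI)
      show "Poly_Mapping.lookup (Poly_Mapping.single (S - {s}) (pullback (map nc_monomial es) d s * Poly_Mapping.single \<alpha> 1)) U
        = Poly_Mapping.lookup (\<Sum>ns\<in>paths d (len a) i j. ext_basis (S - {s}) (path_exp a ((!) ns) + \<alpha>)) U" for U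
        using admissible_in[OF assms, of a i j] s
        by (simp add: aij pullback_relation sum_distrib_right mult_single lookup_sum ext_basis_def
            lookup_single when_def)
    qed
    finally show ?thesis
      by (simp add: aij path_terms_def sgn cscale_def ext_scale_sum)
  qed
  then show ?thesis
    by (auto simp: ext_basis_def koszul_d_single koszul_d_basis_def intro!: sum.cong)
qed

definition lead_list :: "nat set \<Rightarrow> ridx \<Rightarrow> nat list" where
  "lead_list T s = map (lead_nodes T s) [0..<Suc (len (fst s))]"

lemma path_exp_cong: "(\<And>t. t \<le> len a \<Longrightarrow> f t = g t) \<Longrightarrow> path_exp a f = path_exp a g"
  by (simp add: path_exp_def edge_def)

lemma lead_list_in_paths:
  assumes "admissible S \<alpha>" "(a, i, j) \<in> S"
  shows "lead_list (externals S \<alpha>) (a, i, j) \<in> paths d (len a) i j"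
proof -
  let ?ns = "lead_list (externals S \<alpha>) (a, i, j)"
  have "0 < len a" using len_pos admissible_in[OF assms] by blast
  moreover have "?ns \<noteq> []" by (simp add: lead_list_def)
  ultimately have "hd ?ns = i" "last ?ns = j"
    by (simp_all add: lead_list_def hd_conv_nth last_conv_nth lead_nodes_def del: upt_Suc)
  moreover have "set ?ns \<subseteq> {..<d}"
    using lead_nodes_less[OF assms(1) in_relations[OF assms]]
    by (auto simp: lead_list_def simp del: upt_Suc)
  ultimately show ?thesis by (simp add: paths_def lead_list_def)
qed

lemma path_exp_lead_list: "path_exp (fst s) ((!) (lead_list T s)) = lead_exp T s"
  unfolding lead_exp_def by (rule path_exp_cong) (simp add: lead_list_def del: upt_Suc)

text \<open>For fixed external indices \<open>T\<close> this is the Koszul differential of the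
  pairwise coprime monomials with exponents \<open>lead_exp T s\<close>.\<close>

definition lead_d :: "ridx set \<Rightarrow> (('v \<times> nat \<times> nat) \<Rightarrow>\<^sub>0 nat) \<Rightarrow> 'v ext" where
  "lead_d S \<alpha> = (\<Sum>s\<in>S. cscale (ext_sign {s} (S - {s}))
     (ext_basis (S - {s}) (lead_exp (externals S \<alpha>) s + \<alpha>)))"

text \<open>For each relation in \<open>S\<close>, \<open>key_path\<close> puts every path other
  than the leading one below the key.\<close>

lemma koszul_d_lead:
  assumes S: "admissible S \<alpha>" and card: "card S = Suc q"
  shows "D (ext_basis S \<alpha>) - lead_d S \<alpha> \<in> level q (key S \<alpha>)"
proof -
  let ?T = "externals S \<alpha>"
  have fin: "finite S" by (rule admissible_finite[OF S])
  have "D (ext_basis S \<alpha>) - lead_d S \<alpha> =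
    (\<Sum>(a, i, j)\<in>S. path_terms S \<alpha> (a, i, j) (paths d (len a) i j - {lead_list ?T (a, i, j)}))"
    unfolding koszul_d_ext_basis[OF S] lead_d_def sum_subtractf[symmetric]
  proof (rule sum.cong[OF refl])
    fix s assume s: "s \<in> S"
    obtain a i j where aij: "s = (a, i, j)" by (cases s)
    show "(case s of (a, i, j) \<Rightarrow> path_terms S \<alpha> (a, i, j) (paths d (len a) i j)) -
        cscale (ext_sign {s} (S - {s})) (ext_basis (S - {s}) (lead_exp ?T s + \<alpha>)) =
      (case s of (a, i, j) \<Rightarrow> path_terms S \<alpha> (a, i, j) (paths d (len a) i j - {lead_list ?T (a, i, j)}))"
      using sum.remove[OF finite_paths lead_list_in_paths[OF S s[unfolded aij]],
          of "\<lambda>ns. cscale (ext_sign {s} (S - {s})) (ext_basis (S - {s}) (path_exp a ((!) ns) + \<alpha>))"]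
        path_exp_lead_list[of "(a, i, j)" ?T]
      by (simp add: aij path_terms_def)
  qed
  also have "\<dots> \<in> level q (key S \<alpha>)"
    unfolding level_def
  proof (rule ext_span_sum, clarify)
    fix a i j assume s: "(a, i, j) \<in> S"
    show "path_terms S \<alpha> (a, i, j) (paths d (len a) i j - {lead_list ?T (a, i, j)})
        \<in> ext_span (\<lambda>S' \<alpha>'. admissible S' \<alpha>' \<and> card S' = q \<and> key S' \<alpha>' < key S \<alpha>)"
      unfolding path_terms_def prod.case
    proof (intro ext_span_sum ext_span_cscale ext_span_basis conjI)
      fix ns assume ns: "ns \<in> paths d (len a) i j - {lead_list ?T (a, i, j)}"
      have len: "length ns = Suc (len a)" using ns by (simp add: paths_def)
      have less: "ns ! t < d" if "t \<le> len a" for t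
        using ns len that nth_mem[of t ns] by (auto simp: paths_def simp del: nth_mem)
      have ends: "ns ! 0 = i" "ns ! len a = j"
      proof -
        have "ns \<noteq> []" using len by auto
        then show "ns ! 0 = i" "ns ! len a = j"
          using ns len by (auto simp: paths_def hd_conv_nth last_conv_nth)
      qed
      show "admissible (S - {(a, i, j)}) (path_exp a ((!) ns) + \<alpha>)"
        by (rule admissible_path[OF S s less])
      show "card (S - {(a, i, j)}) = q" using fin s card by simp
      have "\<not> (\<forall>t\<le>len a. ns ! t = lead_nodes ?T (a, i, j) t)"
      proof
        assume "\<forall>t\<le>len a. ns ! t = lead_nodes ?T (a, i, j) t"
        then have "ns = lead_list ?T (a, i, j)"
          using len by (intro nth_equalityI) (auto simp: lead_list_def simp del: upt_Suc)
        then show False using ns by simp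
      qed
      then show "key (S - {(a, i, j)}) (path_exp a ((!) ns) + \<alpha>) < key S \<alpha>"
        using key_path[OF S s ends less] by blast
    qed
  qed
  finally show ?thesis .
qed

section \<open>The contraction\<close>

text \<open>The multidegree of a basis element when a generator \<open>s\<close> gets the degree of
  its leading monomial. The leading differential preserves it.\<close>

definition total_exp :: "nat set \<Rightarrow> ridx set \<Rightarrow> (('v \<times> nat \<times> nat) \<Rightarrow>\<^sub>0 nat) \<Rightarrow> ('v \<times> nat \<times> nat) \<Rightarrow>\<^sub>0 nat" where
  "total_exp T S \<alpha> = (\<Sum>s\<in>S. lead_exp T s) + \<alpha>"

text \<open>Since leading monomials are coprime, the leading complex for fixed \<open>T\<close> and
  \<open>\<mu>\<close> is modelled on the subsets \<open>S\<close> of this set, like the chain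
  complex of a simplex.\<close>

definition divisors :: "nat set \<Rightarrow> (('v \<times> nat \<times> nat) \<Rightarrow>\<^sub>0 nat) \<Rightarrow> ridx set" where
  "divisors T \<mu> = {s \<in> relations T. \<forall>x. Poly_Mapping.lookup (lead_exp T s) x \<le> Poly_Mapping.lookup \<mu> x}"

text \<open>Any vertex of the simplex will do, but it must depend on \<open>T\<close> and
  \<open>\<mu>\<close> only: then an element and the terms of its leading differential have the same
  pivot.\<close>

definition pivot :: "nat set \<Rightarrow> (('v \<times> nat \<times> nat) \<Rightarrow>\<^sub>0 nat) \<Rightarrow> ridx" where
  "pivot T \<mu> = (SOME s. s \<in> divisors T \<mu>)"

text \<open>Coning off the pivot: it is added to \<open>S\<close>, and its leading monomial is
  divided out of the coefficient. The subtraction of exponents is exact by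
  \<open>unlead_step\<close>.\<close>

definition contract :: "ridx set \<Rightarrow> (('v \<times> nat \<times> nat) \<Rightarrow>\<^sub>0 nat) \<Rightarrow> 'v ext" where
  "contract S \<alpha> = (let T = externals S \<alpha>; \<mu> = total_exp T S \<alpha>; p = pivot T \<mu> in
     if divisors T \<mu> = {} \<or> p \<in> S then 0
     else cscale (ext_sign {p} S) (ext_basis (insert p S) (\<alpha> - lead_exp T p)))"

lemma total_exp_step:
  "finite S \<Longrightarrow> s \<in> S \<Longrightarrow> total_exp T (S - {s}) (lead_exp T s + \<alpha>) = total_exp T S \<alpha>"
  unfolding total_exp_def using sum.remove[of S s "lead_exp T"] by (simp only: add_ac)

text \<open>The leading monomial of \<open>s\<close> is a factor of the total one. In particular a
  pivot exists whenever \<open>S\<close> is nonempty.\<close>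

lemma subset_divisors: "admissible S \<alpha> \<Longrightarrow> S \<subseteq> divisors (externals S \<alpha>) (total_exp (externals S \<alpha>) S \<alpha>)"
proof
  fix s assume S: "admissible S \<alpha>" and s: "s \<in> S"
  let ?T = "externals S \<alpha>"
  have "total_exp ?T S \<alpha> = lead_exp ?T s + total_exp ?T (S - {s}) \<alpha>"
    unfolding total_exp_def using sum.remove[OF admissible_finite[OF S] s, of "lead_exp ?T"]
    by (simp only: add.assoc)
  then show "s \<in> divisors ?T (total_exp ?T S \<alpha>)"
    using in_relations[OF S s] by (simp add: divisors_def lookup_add)
qed

lemma pivot_in: "divisors T \<mu> \<noteq> {} \<Longrightarrow> pivot T \<mu> \<in> divisors T \<mu>"
  unfolding pivot_def by (rule someI_ex) blast

text \<open>The leading monomial of \<open>p\<close> is coprime to those of \<open>S\<close>, so if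
  it divides the total monomial it already divides that of \<open>\<alpha>\<close>. The other claims
  follow by running the leading step at \<open>p\<close> backwards.\<close>

lemma unlead_step:
  assumes S: "admissible S \<alpha>" and p: "p \<in> divisors (externals S \<alpha>) (total_exp (externals S \<alpha>) S \<alpha>)" "p \<notin> S"
  defines "T \<equiv> externals S \<alpha>"
  defines "\<beta> \<equiv> \<alpha> - lead_exp T p"
  shows "lead_exp T p + \<beta> = \<alpha>"
    and "admissible (insert p S) \<beta>" and "externals (insert p S) \<beta> = T"
    and "key (insert p S) \<beta> = key S \<alpha>"
proof -
  have fin: "finite S" by (rule admissible_finite[OF S])
  have T: "finite T" unfolding T_def by (rule finite_externals[OF fin])
  have rel: "p \<in> relations T" and le: "\<And>x. Poly_Mapping.lookup (lead_exp T p) x \<le> Poly_Mapping.lookup (total_exp T S \<alpha>) x"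
    using p(1) by (auto simp: divisors_def T_def)
  have "Poly_Mapping.lookup (lead_exp T p) x \<le> Poly_Mapping.lookup \<alpha> x" for x
  proof (cases "x \<in> Poly_Mapping.keys (lead_exp T p)")
    case True
    have "Poly_Mapping.lookup (lead_exp T s) x = 0" if "s \<in> S" for s
      using lead_exp_coprime[OF T rel in_relations[OF S that, folded T_def] _ True] that p(2)
      by (auto simp: in_keys_iff)
    then have "Poly_Mapping.lookup (total_exp T S \<alpha>) x = Poly_Mapping.lookup \<alpha> x"
      by (simp add: total_exp_def lookup_add lookup_sum)
    then show ?thesis using le[of x] by simp
  qed (simp add: in_keys_iff)
  then show sum: "lead_exp T p + \<beta> = \<alpha>"
    by (intro poly_mapping_eqI) (simp add: \<beta>_def lookup_add lookup_minus)
  obtain a i j where aij: "p = (a, i, j)" by (cases p)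
  have a: "a < length es" "i \<in> T" "j \<in> T" using rel by (auto simp: aij relations_def)
  have f: "lead_nodes T p 0 = i" "lead_nodes T p (len a) = j"
    using len_pos[OF a(1)] by (simp_all add: aij lead_nodes_def)
  have sp: "special_at a t (edge a (lead_nodes T p) t)" if "t < len a" for t
    using special_at_lead_edge[of p t T] a that by (simp add: aij)
  have exp: "lead_exp T p = path_exp a (lead_nodes T p)" by (simp add: lead_exp_def aij)
  have diff: "insert p S - {(a, i, j)} = S" using p(2) by (auto simp: aij)
  show ext: "externals (insert p S) \<beta> = T"
  proof -
    have "externals (insert p S - {(a, i, j)}) (path_exp a (lead_nodes T p) + \<beta>) = externals (insert p S) \<beta>"
      by (rule externals_path[OF _ a(1) f sp]) (simp add: aij)
    then show ?thesis unfolding diff exp[symmetric] sum by (simp only: T_def)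
  qed
  have "weight (insert p S - {(a, i, j)}) (path_exp a (lead_nodes T p) + \<beta>) = weight (insert p S) \<beta>"
    by (rule weight_path) (simp_all add: fin aij)
  then have "weight (insert p S) \<beta> = weight S \<alpha>"
    unfolding diff exp[symmetric] sum ..
  moreover have "Poly_Mapping.keys \<beta> \<subseteq> Poly_Mapping.keys \<alpha>"
    unfolding arg_cong[OF sum, of Poly_Mapping.keys, symmetric] keys_add_nat by simp
  moreover have "p \<in> {..<length es} \<times> {..<d} \<times> {..<d}"
    using a externals_subset[OF S, folded T_def] by (auto simp: aij)
  ultimately show adm: "admissible (insert p S) \<beta>"
    using S unfolding admissible_def by (simp, blast)
  have "insert p S - {p} = S" using p(2) by simp
  then show "key (insert p S) \<beta> = key S \<alpha>"
    using lead_step(3)[OF adm insertI1] by (simp only: ext sum)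
qed


lemma contract_level:
  assumes S: "admissible S \<alpha>"
  shows "contract S \<alpha> \<in> level (Suc (card S)) (Suc (key S \<alpha>))"
proof -
  let ?T = "externals S \<alpha>"
  let ?\<mu> = "total_exp ?T S \<alpha>"
  let ?p = "pivot ?T ?\<mu>"
  show ?thesis
  proof (cases "divisors ?T ?\<mu> = {} \<or> ?p \<in> S")
    case True
    then show ?thesis by (simp add: contract_def Let_def level_def)
  next
    case False
    then have "ext_basis (insert ?p S) (\<alpha> - lead_exp ?T ?p) \<in> level (Suc (card S)) (Suc (key S \<alpha>))"
      using unlead_step(2,4)[OF S pivot_in] admissible_finite[OF S]
      by (intro level_basis) simp_all
    then show ?thesis
      using False by (simp add: contract_def Let_def level_def ext_span_cscale)
  qed
qed

lemma extend_contract_level: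
  assumes "\<xi> \<in> level q k"
  shows "ext_extend contract \<xi> \<in> level (Suc q) k"
proof (rule level_linear[OF ext_linear_extend _ assms])
  fix S \<alpha> assume "admissible S \<alpha>" "card S = q" "key S \<alpha> < k"
  then show "ext_extend contract (ext_basis S \<alpha>) \<in> level (Suc q) k"
    using level_mono[OF contract_level, of S \<alpha> k] by (auto simp: ext_extend_basis)
qed

lemma contract_step:
  assumes S: "admissible S \<alpha>" and s: "s \<in> S"
  defines "T \<equiv> externals S \<alpha>"
  defines "p \<equiv> pivot T (total_exp T S \<alpha>)"
  shows "contract (S - {s}) (lead_exp T s + \<alpha>) = (if p \<in> S - {s} then 0
    else cscale (ext_sign {p} (S - {s})) (ext_basis (insert p (S - {s})) (lead_exp T s + \<alpha> - lead_exp T p)))"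
proof -
  have "externals (S - {s}) (lead_exp T s + \<alpha>) = T"
    using lead_step(2)[OF S s] by (simp add: T_def)
  moreover have "total_exp T (S - {s}) (lead_exp T s + \<alpha>) = total_exp T S \<alpha>"
    by (rule total_exp_step[OF admissible_finite[OF S] s])
  moreover have "divisors T (total_exp T S \<alpha>) \<noteq> {}"
    using subset_divisors[OF S] s by (auto simp: T_def)
  ultimately show ?thesis
    by (simp add: contract_def Let_def p_def)
qed

lemma extend_contract_lead_d:
  "ext_extend contract (lead_d S \<alpha>) =
    (\<Sum>s\<in>S. cscale (ext_sign {s} (S - {s})) (contract (S - {s}) (lead_exp (externals S \<alpha>) s + \<alpha>)))"
  by (simp add: lead_d_def ext_linear_sum[OF ext_linear_extend]
      ext_linear_cscale[OF ext_linear_extend] ext_extend_basis)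

text \<open>Exchanging \<open>p\<close> and \<open>s\<close> costs one sign, by
  \<open>ext_sign_swap\<close>; this makes the mixed terms in \<open>lead_homotopy\<close>
  cancel.\<close>

lemma ext_sign_exchange:
  assumes "finite S" "p \<notin> S" "s \<in> S"
  shows "ext_sign {p} S * ext_sign {s} (insert p S - {s}) =
    - (ext_sign {s} (S - {s}) * ext_sign {p} (S - {s}) :: complex)"
proof -
  have ps: "insert p S - {s} = {p} \<union> (S - {s})" "S = {s} \<union> (S - {s})" using assms by auto
  have 1: "ext_sign {p} S = ext_sign {p} {s} * (ext_sign {p} (S - {s}) :: complex)"
    using ext_sign_Un_right[of "{p}" "{s}" "S - {s}"] assms(1) ps(2) by simp
  have 2: "ext_sign {s} (insert p S - {s}) = ext_sign {s} {p} * (ext_sign {s} (S - {s}) :: complex)"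
    unfolding ps(1) using assms by (intro ext_sign_Un_right) auto
  have 3: "ext_sign {p} {s} * ext_sign {s} {p} = (- 1 :: complex)"
    using ext_sign_swap[of "{p}" s] assms by auto
  have "x * b * (y * c) = x * y * (c * b)" for x b y c :: complex
    by (simp only: mult_ac)
  then show ?thesis by (simp only: 1 2 3 mult_minus1)
qed

text \<open>The contraction inverts multiplication by the pivot on the leading part, because the leading
  monomials are pairwise coprime.\<close>

lemma lead_homotopy:
  assumes S: "admissible S \<alpha>" and ne: "S \<noteq> {}"
  defines "p \<equiv> pivot (externals S \<alpha>) (total_exp (externals S \<alpha>) S \<alpha>)"
  shows "p \<in> S \<Longrightarrow> ext_extend contract (lead_d S \<alpha>) = ext_basis S \<alpha>"
    and "p \<notin> S \<Longrightarrow> cscale (ext_sign {p} S) (lead_d (insert p S) (\<alpha> - lead_exp (externals S \<alpha>) p)) +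
      ext_extend contract (lead_d S \<alpha>) = ext_basis S \<alpha>"
proof -
  let ?T = "externals S \<alpha>"
  have fin: "finite S" by (rule admissible_finite[OF S])
  note step = contract_step[OF S, folded p_def]
  show "ext_extend contract (lead_d S \<alpha>) = ext_basis S \<alpha>" if p: "p \<in> S"
  proof -
    \<comment> \<open>For \<open>s\<close> other than \<open>p\<close> the pivot is still in
      \<open>S - {s}\<close> and the contraction gives 0; for \<open>s = p\<close> it puts
      \<open>p\<close> back.\<close>
    have "ext_extend contract (lead_d S \<alpha>) = (\<Sum>s\<in>S. if s = p then ext_basis S \<alpha> else 0)"
      unfolding extend_contract_lead_d
      by (rule sum.cong[OF refl])
        (use p in \<open>auto simp: step cscale_cscale ext_sign_sq insert_absorb\<close>)
    then show ?thesis using p fin by simp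
  qed
  show "cscale (ext_sign {p} S) (lead_d (insert p S) (\<alpha> - lead_exp ?T p)) +
      ext_extend contract (lead_d S \<alpha>) = ext_basis S \<alpha>" if p: "p \<notin> S"
  proof -
    define \<beta> where "\<beta> = \<alpha> - lead_exp ?T p"
    have "p \<in> divisors ?T (total_exp ?T S \<alpha>)"
      unfolding p_def using subset_divisors[OF S] ne by (intro pivot_in) auto
    note un = unlead_step[OF S this p, folded \<beta>_def]
    \<comment> \<open>Removing \<open>s\<close> and adding \<open>p\<close> anticommute, so only the
      removal of \<open>p\<close> itself survives, and it returns
      \<open>ext_basis S \<alpha>\<close>.\<close>
    have cancel: "cscale (ext_sign {p} S) (cscale (ext_sign {s} (insert p S - {s}))
          (ext_basis (insert p S - {s}) (lead_exp ?T s + \<beta>))) +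
        cscale (ext_sign {s} (S - {s})) (contract (S - {s}) (lead_exp ?T s + \<alpha>)) = 0"
      if s: "s \<in> S" for s
    proof -
      have "lead_exp ?T s + \<alpha> - lead_exp ?T p = lead_exp ?T s + \<beta>"
        by (subst un(1)[symmetric]) (simp add: add.left_commute)
      moreover have "insert p (S - {s}) = insert p S - {s}" using s p by auto
      moreover have "p \<notin> S - {s}" using p by simp
      ultimately have c: "contract (S - {s}) (lead_exp ?T s + \<alpha>) =
          cscale (ext_sign {p} (S - {s})) (ext_basis (insert p S - {s}) (lead_exp ?T s + \<beta>))"
        by (simp only: step[OF s] if_False)
      have "cscale (- z) \<zeta> + cscale z \<zeta> = 0" for z and \<zeta> :: "'v ext"
        by (rule ext_eqI) simp
      then show ?thesis
        by (simp only: c cscale_cscale ext_sign_exchange[OF fin p s])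
    qed
    have "cscale (ext_sign {p} S) (lead_d (insert p S) \<beta>) =
        cscale (ext_sign {p} S) (cscale (ext_sign {p} (insert p S - {p}))
          (ext_basis (insert p S - {p}) (lead_exp ?T p + \<beta>))) +
        (\<Sum>s\<in>S. cscale (ext_sign {p} S) (cscale (ext_sign {s} (insert p S - {s}))
          (ext_basis (insert p S - {s}) (lead_exp ?T s + \<beta>))))"
      by (simp only: lead_d_def un(3) sum.insert[OF fin p] cscale_add cscale_sum)
    also have "cscale (ext_sign {p} S) (cscale (ext_sign {p} (insert p S - {p}))
          (ext_basis (insert p S - {p}) (lead_exp ?T p + \<beta>))) = ext_basis S \<alpha>"
      using p by (simp add: cscale_cscale ext_sign_sq un(1))
    finally show ?thesis
      unfolding extend_contract_lead_d \<beta>_def[symmetric]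
      by (simp only: add.assoc sum.distrib[symmetric] cancel sum.neutral_const add_0_right cong: sum.cong)
  qed
qed

text \<open>With \<open>lead_d\<close> in place of the differential, \<open>lead_homotopy\<close>
  gives 0. The errors, on \<open>S\<close> and on \<open>insert p S\<close>, have smaller key by
  \<open>koszul_d_lead\<close>, and contracting does not raise it. Positive degree guarantees a
  pivot.\<close>

lemma homotopy:
  assumes S: "admissible S \<alpha>" and card: "card S = Suc q"
  shows "ext_basis S \<alpha> - D (contract S \<alpha>) - ext_extend contract (D (ext_basis S \<alpha>)) \<in> level (Suc q) (key S \<alpha>)"
proof -
  let ?T = "externals S \<alpha>"
  define p where "p = pivot ?T (total_exp ?T S \<alpha>)"
  define \<beta> where "\<beta> = \<alpha> - lead_exp ?T p"
  let ?h = "ext_extend contract"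
  note hlin = ext_linear_extend[of contract]
  have fin: "finite S" by (rule admissible_finite[OF S])
  have ne: "S \<noteq> {}" using card by auto
  have div: "divisors ?T (total_exp ?T S \<alpha>) \<noteq> {}"
    using subset_divisors[OF S] ne by auto
  define e where "e = D (ext_basis S \<alpha>) - lead_d S \<alpha>"
  have he: "?h e \<in> level (Suc q) (key S \<alpha>)"
    unfolding e_def by (rule extend_contract_level[OF koszul_d_lead[OF S card]])
  have hd: "?h (D (ext_basis S \<alpha>)) = ?h (lead_d S \<alpha>) + ?h e"
    using ext_linear_add[OF hlin, of "lead_d S \<alpha>" e] by (simp add: e_def)
  show ?thesis
  proof (cases "p \<in> S")
    case True
    have "contract S \<alpha> = 0" using True by (simp add: contract_def Let_def p_def)
    then have "ext_basis S \<alpha> - D (contract S \<alpha>) - ?h (D (ext_basis S \<alpha>)) = 0 - ?h e"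
      using lead_homotopy(1)[OF S ne] True by (simp add: hd p_def)
    also have "\<dots> \<in> level (Suc q) (key S \<alpha>)"
      using he unfolding level_def by (intro ext_span_diff ext_span_0)
    finally show ?thesis .
  next
    case False
    have pd: "p \<in> divisors ?T (total_exp ?T S \<alpha>)" unfolding p_def by (rule pivot_in[OF div])
    note un = unlead_step[OF S pd False, folded \<beta>_def]
    let ?c = "cscale (ext_sign {p} S)"
    define e' where "e' = D (ext_basis (insert p S) \<beta>) - lead_d (insert p S) \<beta>"
    have e': "e' \<in> level (Suc q) (key S \<alpha>)"
      unfolding e'_def using koszul_d_lead[OF un(2), of "Suc q"] fin False card un(4) by simp
    have "contract S \<alpha> = ?c (ext_basis (insert p S) \<beta>)"
      using div False by (simp add: contract_def Let_def p_def \<beta>_def)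
    then have "D (contract S \<alpha>) = ?c (lead_d (insert p S) \<beta> + e')"
      by (simp add: e'_def ext_linear_cscale[OF ext_linear_koszul_d])
    also have "\<dots> = ?c (lead_d (insert p S) \<beta>) + ?c e'" by (rule cscale_add)
    finally have dc: "D (contract S \<alpha>) = ?c (lead_d (insert p S) \<beta>) + ?c e'" .
    have lh: "ext_basis S \<alpha> = ?c (lead_d (insert p S) \<beta>) + ?h (lead_d S \<alpha>)"
      using lead_homotopy(2)[OF S ne] False by (simp add: p_def \<beta>_def)
    have "ext_basis S \<alpha> - D (contract S \<alpha>) - ?h (D (ext_basis S \<alpha>)) =
        ext_basis S \<alpha> - (?c (lead_d (insert p S) \<beta>) + ?c e') - (?h (lead_d S \<alpha>) + ?h e)"
      by (simp only: dc hd)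
    also have "\<dots> = 0 - ?c e' - ?h e" unfolding lh by simp
    also have "\<dots> \<in> level (Suc q) (key S \<alpha>)"
      using he e' unfolding level_def by (intro ext_span_diff ext_span_0 ext_span_cscale)
    finally show ?thesis .
  qed
qed

section \<open>Exactness by induction on the key\<close>

lemma level_ext_deg:
  assumes "\<xi> \<in> level q k"
  shows "\<xi> \<in> ext_deg q"
  unfolding ext_deg_def
proof (clarify)
  fix S assume "S \<in> Poly_Mapping.keys \<xi>"
  then obtain \<alpha> where "ext_coeff \<xi> S \<alpha> \<noteq> 0"
    by (metis ext_coeff_def in_keys_iff lookup_zero poly_mapping_eqI)
  then have "admissible S \<alpha> \<and> card S = q"
    using assms by (auto simp: level_def ext_span_def)
  then show "finite S \<and> card S = q" using admissible_finite by blast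
qed

text \<open>Subtracting from a cycle the boundary of its contraction leaves, by
  \<open>homotopy\<close>, a cycle in a lower level, which is a boundary by induction.\<close>

lemma level_exact:
  assumes "\<xi> \<in> level (Suc q) k" "D \<xi> = 0"
  shows "\<exists>\<eta>\<in>level (Suc (Suc q)) k. D \<eta> = \<xi>"
  using assms
proof (induction k arbitrary: \<xi>)
  case 0
  then have "\<xi> = 0" by (intro ext_eqI) (simp add: level_def ext_span_def)
  then show ?case by (intro bexI[of _ 0]) (simp_all add: level_def)
next
  case (Suc k)
  let ?h = "ext_extend contract"
  let ?L = "\<lambda>\<xi>. \<xi> - D (?h \<xi>) - ?h (D \<xi>)"
  have lin: "ext_linear ?L"
    by (intro ext_linear_minus ext_linear_id ext_linear_compose[OF ext_linear_koszul_d ext_linear_extend]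
        ext_linear_compose[OF ext_linear_extend ext_linear_koszul_d])
  have h: "?h \<xi> \<in> level (Suc (Suc q)) (Suc k)" by (rule extend_contract_level[OF Suc.prems(1)])
  have L: "?L \<xi> \<in> level (Suc q) k"
  proof (rule level_linear[OF lin _ Suc.prems(1)])
    fix S \<alpha> assume S: "admissible S \<alpha>" "card S = Suc q" "key S \<alpha> < Suc k"
    then show "?L (ext_basis S \<alpha>) \<in> level (Suc q) k"
      using level_mono[OF homotopy[OF S(1,2)], of k] by (simp add: ext_extend_basis)
  qed
  have "D (D (?h \<xi>)) = 0" by (rule koszul_d_square[OF level_ext_deg[OF h]])
  then have "D (?L \<xi>) = 0"
    by (simp add: Suc.prems(2) ext_linear_diff[OF ext_linear_koszul_d] ext_linear_0[OF ext_linear_extend])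
  then obtain \<eta> where \<eta>: "\<eta> \<in> level (Suc (Suc q)) k" "D \<eta> = ?L \<xi>"
    using Suc.IH[OF L] by blast
  have "D (\<eta> + ?h \<xi>) = \<xi>"
    by (simp add: koszul_d_add \<eta>(2) Suc.prems(2) ext_linear_0[OF ext_linear_extend])
  moreover have "\<eta> + ?h \<xi> \<in> level (Suc (Suc q)) (Suc k)"
    using level_mono[OF \<eta>(1), of "Suc k"] h unfolding level_def by (intro ext_span_add) simp_all
  ultimately show ?case by blast
qed

end

section \<open>Monomials and commutators\<close>

lemma keys_nc_monomial [simp]: "Poly_Mapping.keys (nc_monomial w) = {Word w}"
  by (simp add: nc_monomial_def)

lemma nc_monomial_inj: "nc_monomial u = nc_monomial v \<longleftrightarrow> u = v"
  using keys_nc_monomial by (metis singleton_inject word.inject)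

lemma nc_scale_monomial: "nc_scale c (nc_monomial w) = Poly_Mapping.single (Word w) c"
  by (simp add: nc_scale_def nc_monomial_def mult_single)

lemma word_weight_Word: "word_weight m (Word w) = (\<Sum>t<length w. m (w ! t))"
  by (simp add: word_weight_def sum_list_sum_nth atLeast0LessThan)

lemma nc_degree_monomial: "nc_degree m (nc_monomial w) = (\<Sum>t<length w. m (w ! t))"
  by (simp add: nc_degree_def nc_homogeneous_def word_weight_Word)

text \<open>Distinct words are distinct basis vectors of the free algebra; the coefficient at
  \<open>Word w\<close> isolates one of them in a linear relation.\<close>

lemma homogeneous_basis_monomials:
  assumes "distinct es"
  shows "homogeneous_basis m (map nc_monomial es)"
proof -
  have "\<not> nc.dependent (nc_monomial ` A :: 'a ncpoly set)" for A :: "'a list set"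
    unfolding nc.dependent_explicit
  proof clarify
    fix U and u :: "'a ncpoly \<Rightarrow> complex" and v
    assume U: "finite U" "U \<subseteq> nc_monomial ` A" "(\<Sum>v\<in>U. nc_scale (u v) v) = 0"
      and v: "v \<in> U" "u v \<noteq> 0"
    obtain w where w: "v = nc_monomial w" using U v by auto
    have "0 = Poly_Mapping.lookup (\<Sum>v\<in>U. nc_scale (u v) v) (Word w)" by (simp add: U(3))
    also have "\<dots> = (\<Sum>v'\<in>U. if v' = v then u v else 0)"
      unfolding lookup_sum
    proof (rule sum.cong[OF refl])
      fix v' assume "v' \<in> U"
      then obtain w' where "v' = nc_monomial w'" using U by auto
      then show "Poly_Mapping.lookup (nc_scale (u v') v') (Word w) = (if v' = v then u v else 0)"
        by (simp add: nc_scale_monomial lookup_single when_def w nc_monomial_inj)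
    qed
    also have "\<dots> = u v" using U(1) v(1) by simp
    finally show False using v(2) by simp
  qed
  moreover have "inj_on nc_monomial (set es)" by (rule inj_onI) (simp add: nc_monomial_inj)
  ultimately show ?thesis
    using assms by (auto simp: homogeneous_basis_def distinct_map nc_homogeneous_def)
qed

text \<open>A trace functional: the total coefficient of the cyclic class of \<open>u\<close>.
  Asking only for some rotation counts each word once even if \<open>u\<close> is periodic.\<close>

definition cyclic_coeff :: "'v list \<Rightarrow> 'v ncpoly \<Rightarrow> complex" where
  "cyclic_coeff u f = (\<Sum>w\<in>Poly_Mapping.keys f. Poly_Mapping.lookup f w * of_bool (\<exists>n. letters w = rotate n u))"

lemma cyclic_coeff_eq_sum:
  assumes "finite A" "Poly_Mapping.keys f \<subseteq> A"
  shows "cyclic_coeff u f = (\<Sum>w\<in>A. Poly_Mapping.lookup f w * of_bool (\<exists>n. letters w = rotate n u))"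
  unfolding cyclic_coeff_def
  by (rule sum.mono_neutral_left) (use assms in \<open>auto simp: in_keys_iff\<close>)

lemma cyclic_coeff_add: "cyclic_coeff u (f + g) = cyclic_coeff u f + cyclic_coeff u g"
proof -
  let ?A = "Poly_Mapping.keys f \<union> Poly_Mapping.keys g"
  have "Poly_Mapping.keys (f + g) \<subseteq> ?A" by (rule keys_add)
  then show ?thesis
    by (simp only: cyclic_coeff_eq_sum[of ?A] finite_UnI finite_keys Un_upper1 Un_upper2
        lookup_add distrib_right sum.distrib)
qed

lemma cyclic_coeff_0 [simp]: "cyclic_coeff u 0 = 0"
  by (simp add: cyclic_coeff_def)

lemma cyclic_coeff_sum: "cyclic_coeff u (sum f A) = (\<Sum>x\<in>A. cyclic_coeff u (f x))"
  by (induction A rule: infinite_finite_induct) (simp_all add: cyclic_coeff_add)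

lemma cyclic_coeff_single:
  "cyclic_coeff u (Poly_Mapping.single w c) = c * of_bool (\<exists>n. letters w = rotate n u)"
  by (subst cyclic_coeff_eq_sum[of "{w}"]) simp_all

lemma sum_singles: "(\<Sum>w\<in>Poly_Mapping.keys f. Poly_Mapping.single w (Poly_Mapping.lookup f w)) = f"
  by (rule poly_mapping_eqI) (simp add: lookup_sum lookup_single when_def in_keys_iff)

lemma cyclic_coeff_scale: "cyclic_coeff u (nc_scale c f) = c * cyclic_coeff u f"
proof -
  have "nc_scale c f = (\<Sum>w\<in>Poly_Mapping.keys f. Poly_Mapping.single w (c * Poly_Mapping.lookup f w))"
    by (subst sum_singles[of f, symmetric])
      (simp only: nc_scale_def sum_distrib_left mult_single add_0)
  then show ?thesis
    by (simp only: cyclic_coeff_sum cyclic_coeff_single cyclic_coeff_def[of u f] sum_distrib_left mult.assoc)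
qed

text \<open>The concatenations of two words in either order are rotations of each other.\<close>

lemma cyclic_coeff_mult_commute: "cyclic_coeff u (f * g) = cyclic_coeff u (g * f)"
proof -
  have expand: "cyclic_coeff u (f * g) = (\<Sum>v\<in>Poly_Mapping.keys f. \<Sum>w\<in>Poly_Mapping.keys g.
      Poly_Mapping.lookup f v * Poly_Mapping.lookup g w * of_bool (\<exists>n. letters (v + w) = rotate n u))"
    for f g :: "'a ncpoly"
  proof -
    have "f * g = (\<Sum>v\<in>Poly_Mapping.keys f. \<Sum>w\<in>Poly_Mapping.keys g.
        Poly_Mapping.single (v + w) (Poly_Mapping.lookup f v * Poly_Mapping.lookup g w))"
      by (subst (1) sum_singles[of f, symmetric], subst (1) sum_singles[of g, symmetric])
        (simp only: sum_distrib_left sum_distrib_right mult_single, rule sum.swap)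
    then show ?thesis by (simp only: cyclic_coeff_sum cyclic_coeff_single)
  qed
  have half: "\<exists>n. letters (w + v) = rotate n u" if ex: "\<exists>n. letters (v + w) = rotate n u" for v w :: "'a word"
  proof -
    obtain n where "letters (v + w) = rotate n u" using ex ..
    then have "letters v @ letters w = rotate n u" by (simp add: plus_word_def)
    then have "letters w @ letters v = rotate (length (letters v) + n) u"
      by (metis rotate_append rotate_rotate)
    then show ?thesis by (auto simp: plus_word_def)
  qed
  have "(\<exists>n. letters (v + w) = rotate n u) = (\<exists>n. letters (w + v) = rotate n u)" for v w :: "'a word"
    using half by blast
  then show ?thesis
    unfolding expand by (subst sum.swap) (simp only: mult.commute)
qed

lemma cyclic_coeff_commutator:
  assumes "f \<in> commutator_space"
  shows "cyclic_coeff u f = 0"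
proof -
  have "nc.subspace {f. cyclic_coeff u f = 0}"
    by (simp add: nc.subspace_def cyclic_coeff_add cyclic_coeff_scale)
  moreover have "f * g - g * f \<in> {f. cyclic_coeff u f = 0}" for f g :: "'a ncpoly"
    using cyclic_coeff_add[of u "f * g - g * f" "g * f"] cyclic_coeff_mult_commute[of u f g] by simp
  ultimately have "commutator_space \<subseteq> {f. cyclic_coeff u f = 0}"
    unfolding commutator_space_def by (intro nc.span_minimal) auto
  then show ?thesis using assms by blast
qed

context nonoverlapping_words
begin

text \<open>A rotation starts with a nonempty suffix of \<open>es ! a\<close>, which is thus also a
  prefix of \<open>es ! b\<close>.\<close>

lemma rotate_relation:
  assumes "a < length es" "b < length es" "es ! b = rotate n (es ! a)"
  shows "a = b"
proof -
  let ?k = "n mod len a"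
  have eq: "es ! b = drop ?k (es ! a) @ take ?k (es ! a)"
    using assms(3) by (simp add: rotate_drop_take)
  have "drop ?k (es ! a) \<noteq> []" using len_pos[OF assms(1)] by (simp add: not_le)
  moreover have "prefix (drop ?k (es ! a)) (es ! b)" unfolding eq by simp
  ultimately show ?thesis
    using prefix_suffix_nth_eq(1)[OF assms(2,1), of "drop ?k (es ! a)"] suffix_drop by blast
qed

text \<open>No two relations are cyclic rotations of each other, so \<open>L \<inter> [TV, TV] = 0\<close>.\<close>

lemma trace_forms_trivial: "trace_forms (map nc_monomial es) d \<subseteq> {0}"
proof
  fix \<tau> :: "'v ext" assume "\<tau> \<in> trace_forms (map nc_monomial es) d"
  then obtain c where \<tau>: "\<tau> = trace_form (map nc_monomial es) d c"
    and c: "(\<Sum>a<length es. nc_scale (c a) (map nc_monomial es ! a)) \<in> commutator_space"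
    by (auto simp: trace_forms_def)
  have "c b = 0" if b: "b < length es" for b
  proof -
    have "0 = (\<Sum>a<length es. cyclic_coeff (es ! b) (nc_scale (c a) (map nc_monomial es ! a)))"
      using cyclic_coeff_commutator[OF c] by (simp add: cyclic_coeff_sum)
    also have "\<dots> = (\<Sum>a<length es. if a = b then c b else 0)"
    proof (rule sum.cong[OF refl])
      fix a assume "a \<in> {..<length es}"
      moreover have "\<exists>n. es ! b = rotate n (es ! b)" by (rule exI[of _ 0]) simp
      ultimately show "cyclic_coeff (es ! b) (nc_scale (c a) (map nc_monomial es ! a)) = (if a = b then c b else 0)"
        using rotate_relation[OF b, of a] by (auto simp: nc_scale_monomial cyclic_coeff_single)
    qed
    also have "\<dots> = c b" using b by simp
    finally show ?thesis by simp
  qed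
  then show "\<tau> \<in> {0}" by (simp add: \<tau> trace_form_def cconst_def)
qed

text \<open>With all generators zero, the conditions modulo the ideal become equations in the
  exterior algebra.\<close>

lemma trace_ideal_trivial: "trace_ideal (map nc_monomial es) d = {0}"
proof -
  have "\<xi> = 0" if "\<xi> \<in> trace_ideal (map nc_monomial es) d" for \<xi>
    using that
  proof induction
    case (add \<xi> \<tau> \<eta>)
    then have "\<tau> = 0" using trace_forms_trivial by blast
    then show ?case using add.IH by simp
  qed simp
  then show ?thesis using trace_ideal.zero by blast
qed

end

section \<open>Comparison with the Koszul complex of the definition\<close>

context truncated_koszul
begin

lemma admissible_iff:
  "admissible S \<alpha> \<longleftrightarrow> S \<subseteq> {..<length es} \<times> {..<d} \<times> {..<d} \<and>
    Poly_Mapping.keys \<alpha> \<subseteq> UNIV \<times> {..<d} \<times> {..<d} \<and>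
    monom_weight m \<alpha> + (\<Sum>(a, i, j)\<in>S. nc_degree m (map nc_monomial es ! a)) \<le> r"
proof -
  have "(\<Sum>(a, i, j)\<in>S. nc_degree m (map nc_monomial es ! a)) = (\<Sum>(a, i, j)\<in>S. \<Sum>t<len a. m (es ! a ! t))"
    if "S \<subseteq> {..<length es} \<times> {..<d} \<times> {..<d}"
    by (rule sum.cong[OF refl]) (use that in \<open>auto simp: nc_degree_monomial\<close>)
  then show ?thesis
    by (auto simp: admissible_def weight_def monom_weight_def wt_def add.commute)
qed

lemma ext_coeff_nonzeroD:
  assumes "ext_coeff \<xi> S \<alpha> \<noteq> 0"
  shows "S \<in> Poly_Mapping.keys \<xi>" "\<alpha> \<in> Poly_Mapping.keys (Poly_Mapping.lookup \<xi> S)"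
  using assms by (auto simp: ext_coeff_def in_keys_iff)

text \<open>An element has finite support, so the keys occurring in it are bounded and the levels
  exhaust the truncated complex.\<close>

lemma level_complex:
  "\<xi> \<in> ext_alg (map nc_monomial es) d \<inter> ext_deg q \<inter> ext_weight_le m (map nc_monomial es) r \<longleftrightarrow>
    (\<exists>k. \<xi> \<in> level q k)"
proof
  let ?es = "map nc_monomial es"
  assume \<xi>: "\<xi> \<in> ext_alg ?es d \<inter> ext_deg q \<inter> ext_weight_le m ?es r"
  define k where "k = Suc (\<Sum>(S, \<alpha>)\<in>ext_supp \<xi>. key S \<alpha>)"
  have "admissible S \<alpha> \<and> card S = q \<and> key S \<alpha> < k" if nz: "ext_coeff \<xi> S \<alpha> \<noteq> 0" for S \<alpha>
  proof (intro conjI)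
    note keys = ext_coeff_nonzeroD[OF nz]
    have "S \<subseteq> {..<length es} \<times> {..<d} \<times> {..<d}" "Poly_Mapping.lookup \<xi> S \<in> coord_ring d"
      using \<xi> keys(1) unfolding ext_alg_def by auto
    moreover have "monom_weight m \<alpha> + (\<Sum>(a, i, j)\<in>S. nc_degree m (?es ! a)) \<le> r"
      using \<xi> keys unfolding ext_weight_le_def by blast
    ultimately show "admissible S \<alpha>"
      using keys(2) unfolding admissible_iff coord_ring_def by blast
    show "card S = q" using \<xi> keys(1) by (auto simp: ext_deg_def)
    have "(S, \<alpha>) \<in> ext_supp \<xi>" using nz by (simp add: ext_supp_def)
    then have "key S \<alpha> \<le> (\<Sum>(S, \<alpha>)\<in>ext_supp \<xi>. key S \<alpha>)"
      using member_le_sum[of "(S, \<alpha>)" "ext_supp \<xi>" "\<lambda>(S, \<alpha>). key S \<alpha>"] by simp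
    then show "key S \<alpha> < k" by (simp add: k_def)
  qed
  then have "\<xi> \<in> level q k" by (auto simp: level_def ext_span_def)
  then show "\<exists>k. \<xi> \<in> level q k" ..
next
  let ?es = "map nc_monomial es"
  assume "\<exists>k. \<xi> \<in> level q k"
  then obtain k where k: "\<xi> \<in> level q k" ..
  have adm: "admissible S \<alpha>" if "\<alpha> \<in> Poly_Mapping.keys (Poly_Mapping.lookup \<xi> S)" for S \<alpha>
    using k that by (auto simp: level_def ext_span_def ext_coeff_def in_keys_iff)
  have ex: "\<exists>\<alpha>. \<alpha> \<in> Poly_Mapping.keys (Poly_Mapping.lookup \<xi> S)" if "S \<in> Poly_Mapping.keys \<xi>" for S
    using that by (metis in_keys_iff lookup_zero poly_mapping_eqI)
  have "\<xi> \<in> ext_alg ?es d"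
    unfolding ext_alg_def coord_ring_def using adm ex by (simp add: admissible_iff) blast
  moreover have "\<xi> \<in> ext_weight_le m ?es r"
    unfolding ext_weight_le_def using adm by (simp add: admissible_iff)
  ultimately show "\<xi> \<in> ext_alg ?es d \<inter> ext_deg q \<inter> ext_weight_le m ?es r"
    using level_ext_deg[OF k] by simp
qed

lemma homology_vanishes:
  assumes "0 < q"
  shows "koszul_homology_vanishes m (map nc_monomial es) d r q"
  unfolding koszul_homology_vanishes_def trace_ideal_trivial
proof (intro ballI impI)
  fix \<xi> :: "'v ext"
  assume "\<xi> \<in> ext_alg (map nc_monomial es) d \<inter> ext_deg q \<inter> ext_weight_le m (map nc_monomial es) r"
    and "D \<xi> \<in> {0}"
  then obtain k where k: "\<xi> \<in> level q k" "D \<xi> = 0" using level_complex by blast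
  obtain q' where q': "q = Suc q'" using assms by (cases q) auto
  obtain \<eta> where \<eta>: "\<eta> \<in> level (Suc q) k" "D \<eta> = \<xi>" using level_exact k unfolding q' by blast
  then have "\<eta> \<in> ext_alg (map nc_monomial es) d \<inter> ext_deg (Suc q) \<inter> ext_weight_le m (map nc_monomial es) r"
    using level_complex by blast
  then show "\<exists>\<eta>\<in>ext_alg (map nc_monomial es) d \<inter> ext_deg (Suc q) \<inter> ext_weight_le m (map nc_monomial es) r.
      \<xi> - D \<eta> \<in> {0}"
    using \<eta>(2) by auto
qed

end

theorem theorem5p4p1:
  fixes m :: "'v::finite \<Rightarrow> nat" and es :: "'v list list"
  assumes "\<And>k. 0 < m k"
    and "distinct es"
    and "\<And>e f. e \<in> set es \<Longrightarrow> f \<in> set es \<Longrightarrow> nonoverlapping e f"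
  shows "asymptotic_RCI m (map nc_monomial es)"
  unfolding asymptotic_RCI_def
proof (intro conjI allI impI)
  show "homogeneous_basis m (map nc_monomial es)"
    by (rule homogeneous_basis_monomials[OF assms(2)])
  fix r N :: nat
  \<comment> \<open>The inner nodes demanded by \<open>inner_node_less\<close> are finitely many, so
    one \<open>d\<close> exceeds all of them as well as \<open>N\<close>.\<close>
  let ?X = "(\<lambda>(a, t, p, q). inner_node a t p q) `
    (SIGMA a:{..<length es}. {..<length (es ! a)} \<times> {..<2 * r} \<times> {..<2 * r})"
  have "finite ?X" by (intro finite_imageI finite_SigmaI finite_cartesian_product finite_lessThan)
  then obtain b where b: "\<forall>x\<in>?X. x < b" unfolding finite_nat_set_iff_bounded ..
  define d where "d = max b (Suc N)"
  interpret truncated_koszul es m d r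
  proof
    fix a t p q assume "a < length es" "t < length (es ! a)" "p < 2 * r" "q < 2 * r"
    then have "inner_node a t p q \<in> ?X" by (intro image_eqI[of _ _ "(a, t, p, q)"]) auto
    then show "inner_node a t p q < d" using b by (auto simp: d_def less_max_iff_disj)
  qed (use assms in auto)
  show "\<exists>d>N. \<forall>q>0. koszul_homology_vanishes m (map nc_monomial es) d r q"
    using homology_vanishes by (intro exI[of _ d]) (auto simp: d_def)
qed

end
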